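(* Let $I$ be a nonempty totally ordered set and $A$ a unital ring. Consider the groupoid $\Gamma:=I\times I$ and the $\Gamma$-graded ring $R:=\mathrm{UT}_I(A)$. The following assertions hold: (1) If $A$ is right artinian and, for each $i\in I$, there exists $n_i\in\mathbb{N}$ such that $I$ contains no chains of the form $i<k_1<k_2<\cdots<k_{n_i}$, then $R$ is a right $\Gamma_0$-artinian ring and $\mathrm{rad}^{\mathrm{gr}}(R)$ is right objectwise nilpotent. (2) If $A$ is left artinian and, for each $j\in I$, there exists $n_j\in\mathbb{N}$ such that $I$ contains no chains of the form $k_1<k_2<\cdots<k_{n_j}<j$, then $R$ is a left $\Gamma_0$-artinian ring and $\mathrm{rad}^{\mathrm{gr}}(R)$ is left objectwise nilpotent. (3) If $A$ is left artinian and $I$ is an infinite well-ordered set, then $R$ is a left $\Gamma_0$-artinian ring and $\mathrm{rad}^{\mathrm{gr}}(R)$ is not right objectwise nilpotent. (4) If $A$ is left artinian and $I=\mathbb{N}$, then $R$ is a left $\Gamma_0$-artinian ring and $\mathrm{rad}^{\mathrm{gr}}(R)$ is left objectwise nilpotent but not right objectwise nilpotent. (5) Suppose that $A$ is left artinian and $I$ is the set of ordinals less than $\lambda$, where $\lambda$ is an ordinal greater than the first infinite ordinal $\omega$. Then $R$ is a left $\Gamma_0$-artinian ring and $\mathrm{rad}^{\mathrm{gr}}(R)$ is neither left nor right objectwise nilpotent.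
   Context: For a nonempty set $I$, $\Gamma=I\times I$ is a groupoid with $(k,j)(j,i)=(k,i)$ (other products undefined), and $\Gamma_0=\{(i,i):i\in I\}$. For a unital ring $A$, $\mathrm{M}_I(A)$ is the ring of $I\times I$ matrices over $A$ with finitely many nonzero entries; for $I$ partially ordered, $\mathrm{UT}_I(A)$ is the subring of matrices $(a_{ij})_{ij}$ with $a_{ij}=0$ whenever $i\not\le j$. It is $\Gamma$-graded: for $R=\mathrm{UT}_I(A)$, $R_{(i,j)}=AE_{ij}$ if $i\le j$ and $R_{(i,j)}=0$ otherwise ($E_{ij}$ the elementary matrix); put $1_e=E_{ii}$ for $e=(i,i)$. A one- or two-sided ideal $U$ of $R$ is graded if $U=\bigoplus_{\gamma}(U\cap R_\gamma)$. $R$ is right (resp. left) $\Gamma_0$-artinian if for every $e\in\Gamma_0$ there is no infinite strictly decreasing chain of graded right ideals contained in $1_eR$ (resp. graded left ideals contained in $R1_e$). $\mathrm{rad}^{\mathrm{gr}}(R)$ is the intersection of all gr-maximal graded right ideals of $R$ (those maximal among proper graded right ideals); it is a graded two-sided ideal. A graded ideal $U$ is right (resp. left) objectwise nilpotent if for each $e\in\Gamma_0$ there is a positive integer $n_e$ with $1_eU^{n_e}=0$ (resp. $U^{n_e}1_e=0$). *)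

theory Defs
  imports Main "HOL-Library.Groups_Big_Fun" "HOL-Computational_Algebra.Group_Closure"
begin

unbundle cardinal_syntax

section \<open>One-sided ideals in rings that need not be unital\<close>

definition right_ideal :: "'r::ring set \<Rightarrow> bool" where
  "right_ideal U \<longleftrightarrow>
     0 \<in> U \<and> (\<forall>x\<in>U. \<forall>y\<in>U. x - y \<in> U) \<and> (\<forall>x\<in>U. \<forall>r. x * r \<in> U)"

definition left_ideal :: "'r::ring set \<Rightarrow> bool" where
  "left_ideal U \<longleftrightarrow>
     0 \<in> U \<and> (\<forall>x\<in>U. \<forall>y\<in>U. x - y \<in> U) \<and> (\<forall>x\<in>U. \<forall>r. r * x \<in> U)"

definition right_artinian :: "'a::ring_1 itself \<Rightarrow> bool" where
  "right_artinian _ \<longleftrightarrow>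
     \<not> (\<exists>U :: nat \<Rightarrow> 'a set. \<forall>n. right_ideal (U n) \<and> U (Suc n) \<subset> U n)"

definition left_artinian :: "'a::ring_1 itself \<Rightarrow> bool" where
  "left_artinian _ \<longleftrightarrow>
     \<not> (\<exists>U :: nat \<Rightarrow> 'a set. \<forall>n. left_ideal (U n) \<and> U (Suc n) \<subset> U n)"

text \<open>
  Powers of an ideal: \<open>U\<^sup>n\<close> consists of the finite sums of \<open>n\<close>-fold products. A ring without
  unit has no natural zeroth power; the value at \<open>0\<close> is a convention that is never used.
\<close>

fun ideal_power :: "'r::ring set \<Rightarrow> nat \<Rightarrow> 'r set" where
  "ideal_power U 0 = UNIV"
| "ideal_power U (Suc 0) = U"
| "ideal_power U (Suc (Suc n)) = group_closure {x * y | x y. x \<in> ideal_power U (Suc n) \<and> y \<in> U}"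


section \<open>Rings graded by a groupoid\<close>

text \<open>
  The ring is the whole type \<open>'r\<close>. The field \<open>objects\<close> is the set \<open>\<Gamma>\<^sub>0\<close> of identities of the
  groupoid, and \<open>local_one e\<close> is \<open>1\<^sub>e\<close>; it is only meaningful for \<open>e \<in> \<Gamma>\<^sub>0\<close>.
\<close>

record ('g, 'r) graded_ring =
  objects :: "'g set"
  component :: "'g \<Rightarrow> 'r set"
  local_one :: "'g \<Rightarrow> 'r"

definition internal_direct_sum :: "('g \<Rightarrow> 'r::ab_group_add set) \<Rightarrow> 'r set \<Rightarrow> bool" where
  "internal_direct_sum C U \<longleftrightarrow>
     bij_betw (\<lambda>f. \<Sum>g | f g \<noteq> 0. f g) {f. (\<forall>g. f g \<in> C g) \<and> finite {g. f g \<noteq> 0}} U"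

definition graded_subset :: "('g, 'r::ring) graded_ring \<Rightarrow> 'r set \<Rightarrow> bool" where
  "graded_subset R U \<longleftrightarrow> internal_direct_sum (\<lambda>g. U \<inter> component R g) U"

definition graded_right_ideal :: "('g, 'r::ring) graded_ring \<Rightarrow> 'r set \<Rightarrow> bool" where
  "graded_right_ideal R U \<longleftrightarrow> right_ideal U \<and> graded_subset R U"

definition graded_left_ideal :: "('g, 'r::ring) graded_ring \<Rightarrow> 'r set \<Rightarrow> bool" where
  "graded_left_ideal R U \<longleftrightarrow> left_ideal U \<and> graded_subset R U"

definition right_objects_artinian :: "('g, 'r::ring) graded_ring \<Rightarrow> bool" where
  "right_objects_artinian R \<longleftrightarrow>
     (\<forall>e\<in>objects R. \<not> (\<exists>U :: nat \<Rightarrow> 'r set. \<forall>n.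
        graded_right_ideal R (U n) \<and> U n \<subseteq> {local_one R e * x | x. True} \<and> U (Suc n) \<subset> U n))"

definition left_objects_artinian :: "('g, 'r::ring) graded_ring \<Rightarrow> bool" where
  "left_objects_artinian R \<longleftrightarrow>
     (\<forall>e\<in>objects R. \<not> (\<exists>U :: nat \<Rightarrow> 'r set. \<forall>n.
        graded_left_ideal R (U n) \<and> U n \<subseteq> {x * local_one R e | x. True} \<and> U (Suc n) \<subset> U n))"

definition gr_maximal_right_ideal :: "('g, 'r::ring) graded_ring \<Rightarrow> 'r set \<Rightarrow> bool" where
  "gr_maximal_right_ideal R M \<longleftrightarrow>
     graded_right_ideal R M \<and> M \<noteq> UNIV \<and>
     (\<forall>N. graded_right_ideal R N \<longrightarrow> N \<noteq> UNIV \<longrightarrow> M \<subseteq> N \<longrightarrow> N = M)"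

definition rad_gr :: "('g, 'r::ring) graded_ring \<Rightarrow> 'r set" where
  "rad_gr R = \<Inter> {M. gr_maximal_right_ideal R M}"

text \<open>
  The next two notions are meant for graded two-sided ideals \<open>U\<close>. That \<open>U\<close> is one is not part
  of the definitions, so that their negations say nothing but the failure of nilpotency.
\<close>

definition right_objectwise_nilpotent :: "('g, 'r::ring) graded_ring \<Rightarrow> 'r set \<Rightarrow> bool" where
  "right_objectwise_nilpotent R U \<longleftrightarrow>
     (\<forall>e\<in>objects R. \<exists>n>0. {local_one R e * x | x. x \<in> ideal_power U n} = {0})"

definition left_objectwise_nilpotent :: "('g, 'r::ring) graded_ring \<Rightarrow> 'r set \<Rightarrow> bool" where
  "left_objectwise_nilpotent R U \<longleftrightarrow>
     (\<forall>e\<in>objects R. \<exists>n>0. {x * local_one R e | x. x \<in> ideal_power U n} = {0})"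


section \<open>Upper triangular matrices with finitely many nonzero entries\<close>

typedef (overloaded) ('i, 'a) ut =
  "{M :: 'i::order \<Rightarrow> 'i \<Rightarrow> 'a::zero. finite {(i, j). M i j \<noteq> 0} \<and> (\<forall>i j. \<not> i \<le> j \<longrightarrow> M i j = 0)}"
  morphisms entry Abs_ut
  by (rule exI[of _ "\<lambda>_ _. 0"]) simp

setup_lifting type_definition_ut

lemma ut_eqI: "(\<And>i j. entry M i j = entry N i j) \<Longrightarrow> M = N"
  by (metis (no_types) entry_inject ext)

lemma finite_entry: "finite {(i, j). entry M i j \<noteq> 0}"
  using entry[of M] by simp

lemma entry_eq_0: "\<not> i \<le> j \<Longrightarrow> entry M i j = 0"
  using entry[of M] by simp

lemma finite_row: "finite {k. entry M i k \<noteq> 0}"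
proof -
  have "{k. entry M i k \<noteq> 0} \<subseteq> snd ` {(i, j). entry M i j \<noteq> 0}"
    by force
  then show ?thesis
    using finite_entry finite_subset by blast
qed

lemma finite_col: "finite {k. entry M k j \<noteq> 0}"
proof -
  have "{k. entry M k j \<noteq> 0} \<subseteq> fst ` {(i, j). entry M i j \<noteq> 0}"
    by force
  then show ?thesis
    using finite_entry finite_subset by blast
qed

instantiation ut :: (order, ring) ring
begin

lift_definition zero_ut :: "('a, 'b) ut" is "\<lambda>_ _. 0"
  by simp

lift_definition plus_ut :: "('a, 'b) ut \<Rightarrow> ('a, 'b) ut \<Rightarrow> ('a, 'b) ut" is
  "\<lambda>M N i j. M i j + N i j"
proof (intro conjI)
  fix M N :: "'a \<Rightarrow> 'a \<Rightarrow> 'b"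
  assume *: "finite {(i, j). M i j \<noteq> 0} \<and> (\<forall>i j. \<not> i \<le> j \<longrightarrow> M i j = 0)"
    "finite {(i, j). N i j \<noteq> 0} \<and> (\<forall>i j. \<not> i \<le> j \<longrightarrow> N i j = 0)"
  have "{(i, j). M i j + N i j \<noteq> 0} \<subseteq> {(i, j). M i j \<noteq> 0} \<union> {(i, j). N i j \<noteq> 0}"
    by auto
  then show "finite {(i, j). M i j + N i j \<noteq> 0}"
    using * by (auto elim: finite_subset)
  show "\<forall>i j. \<not> i \<le> j \<longrightarrow> M i j + N i j = 0"
    using * by simp
qed

lift_definition uminus_ut :: "('a, 'b) ut \<Rightarrow> ('a, 'b) ut" is "\<lambda>M i j. - M i j"
  by simp

definition minus_ut :: "('a, 'b) ut \<Rightarrow> ('a, 'b) ut \<Rightarrow> ('a, 'b) ut" where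
  "minus_ut M N = M + (- N)"

text \<open>\<open>Sum_any\<close> is the sum over the (here always finite) support of the summand.\<close>

lift_definition times_ut :: "('a, 'b) ut \<Rightarrow> ('a, 'b) ut \<Rightarrow> ('a, 'b) ut" is
  "\<lambda>M N i j. Sum_any (\<lambda>k. M i k * N k j)"
proof (intro conjI)
  fix M N :: "'a \<Rightarrow> 'a \<Rightarrow> 'b"
  assume *: "finite {(i, j). M i j \<noteq> 0} \<and> (\<forall>i j. \<not> i \<le> j \<longrightarrow> M i j = 0)"
    "finite {(i, j). N i j \<noteq> 0} \<and> (\<forall>i j. \<not> i \<le> j \<longrightarrow> N i j = 0)"
  have "{(i, j). Sum_any (\<lambda>k. M i k * N k j) \<noteq> 0}
      \<subseteq> fst ` {(i, j). M i j \<noteq> 0} \<times> snd ` {(i, j). N i j \<noteq> 0}"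
  proof (rule subsetI, elim CollectE case_prodE)
    fix p i j
    assume p: "p = (i, j)" and nz: "Sum_any (\<lambda>k. M i k * N k j) \<noteq> 0"
    from nz obtain k where "M i k * N k j \<noteq> 0"
      by (rule Sum_any.not_neutral_obtains_not_neutral)
    then have "M i k \<noteq> 0" "N k j \<noteq> 0"
      by auto
    then show "p \<in> fst ` {(i, j). M i j \<noteq> 0} \<times> snd ` {(i, j). N i j \<noteq> 0}"
      unfolding p by force
  qed
  moreover have "finite (fst ` {(i, j). M i j \<noteq> 0} \<times> snd ` {(i, j). N i j \<noteq> 0})"
    using * by auto
  ultimately show "finite {(i, j). Sum_any (\<lambda>k. M i k * N k j) \<noteq> 0}"
    using finite_subset by blast
  show "\<forall>i j. \<not> i \<le> j \<longrightarrow> Sum_any (\<lambda>k. M i k * N k j) = 0"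
  proof (intro allI impI)
    fix i j :: 'a
    assume "\<not> i \<le> j"
    then have "M i k * N k j = 0" for k
      using * by (metis mult_zero_left mult_zero_right order_trans)
    then show "Sum_any (\<lambda>k. M i k * N k j) = 0"
      by simp
  qed
qed

lemma finite_prod_support:
  "finite {k. entry M i k * entry N k j \<noteq> (0 :: 'b)}" for M N :: "('a, 'b) ut"
  by (rule finite_subset[OF _ finite_row[of M i]]) auto

instance
proof
  fix L M N :: "('a, 'b) ut"
  show "L + M + N = L + (M + N)" "L + M = M + L" "0 + L = L" "- L + L = 0" "L - M = L + - M"
    by (auto intro!: ut_eqI simp: plus_ut.rep_eq zero_ut.rep_eq uminus_ut.rep_eq minus_ut_def
        algebra_simps)
  show "(L + M) * N = L * N + M * N" "L * (M + N) = L * M + L * N"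
    by (auto intro!: ut_eqI simp: plus_ut.rep_eq times_ut.rep_eq distrib_left distrib_right
        Sum_any.distrib finite_prod_support)
  show "L * M * N = L * (M * N)"
  proof (rule ut_eqI)
    fix i j
    let ?A = "{k. entry L i k \<noteq> 0}" and ?B = "{k. entry N k j \<noteq> 0}"
    have "entry (L * M * N) i j
        = Sum_any (\<lambda>l. Sum_any (\<lambda>k. entry L i k * entry M k l * entry N l j))"
      by (simp add: times_ut.rep_eq Sum_any_left_distrib finite_prod_support)
    also have "\<dots> = Sum_any (\<lambda>k. Sum_any (\<lambda>l. entry L i k * entry M k l * entry N l j))"
      by (rule Sum_any.swap[where C = "?B \<times> ?A"])
        (auto simp: finite_row finite_col)
    also have "\<dots> = entry (L * (M * N)) i j"
      by (simp add: times_ut.rep_eq Sum_any_right_distrib finite_prod_support mult.assoc)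
    finally show "entry (L * M * N) i j = entry (L * (M * N)) i j" .
  qed
qed

end

text \<open>For \<open>i \<le> j\<close> this is \<open>a E\<^sub>i\<^sub>j\<close>; otherwise it is \<open>0\<close>, as \<open>E\<^sub>i\<^sub>j\<close> is then not upper triangular.\<close>

lift_definition elementary :: "'i::order \<Rightarrow> 'i \<Rightarrow> 'a::zero \<Rightarrow> ('i, 'a) ut" is
  "\<lambda>i j a k l. if k = i \<and> l = j \<and> i \<le> j then a else 0"
  by (auto intro: finite_subset[where B = "{(_, _)}"])

definition ut_component :: "'i::order \<times> 'i \<Rightarrow> ('i, 'a::zero) ut set" where
  "ut_component = (\<lambda>(i, j). {elementary i j a | a. True})"

text \<open>
  \<open>UT\<close> is the ring of upper triangular \<open>I \<times> I\<close> matrices over a unital ring, graded by the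
  groupoid \<open>I \<times> I\<close>, where \<open>I\<close> is the whole index type. The lemmas \<open>UT_direct_sum\<close>,
  \<open>UT_component_mult\<close> and \<open>UT_local_one\<close> below show that this is a grading by the groupoid
  with product \<open>(k, j)(j, i) = (k, i)\<close>.
\<close>

definition UT :: "'i::order itself \<Rightarrow> 'a::ring_1 itself \<Rightarrow> ('i \<times> 'i, ('i, 'a) ut) graded_ring" where
  "UT _ _ = \<lparr>objects = {(i, i) | i. True}, component = ut_component,
             local_one = (\<lambda>(i, j). elementary i j 1)\<rparr>"

lemma ut_component_iff:
  "M \<in> ut_component g \<longleftrightarrow> (\<forall>k l. (k, l) \<noteq> g \<longrightarrow> entry M k l = 0)"
proof (cases g)
  case (Pair i j)
  have "M = elementary i j (entry M i j)" if "\<forall>k l. (k, l) \<noteq> (i, j) \<longrightarrow> entry M k l = 0"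
  proof (rule ut_eqI)
    fix k l
    show "entry M k l = entry (elementary i j (entry M i j)) k l"
      using that[rule_format, of k l] entry_eq_0[of i j M] by (auto simp: elementary.rep_eq)
  qed
  then show ?thesis
    using Pair by (auto simp: ut_component_def elementary.rep_eq)
qed

lemma elementary_mult:
  "i \<le> j \<Longrightarrow> k \<le> l \<Longrightarrow> elementary i j a * elementary k l (b :: 'a::ring)
     = (if j = k then elementary i l (a * b) else 0)"
proof (intro ut_eqI)
  fix p q
  assume ij: "i \<le> j" and kl: "k \<le> l"
  have "(\<lambda>m. entry (elementary i j a) p m * entry (elementary k l b) m q)
      = (\<lambda>m. if m = j then (if p = i \<and> j = k \<and> q = l then a * b else 0) else 0)"
    using ij kl by (auto simp: elementary.rep_eq fun_eq_iff)
  then have "Sum_any (\<lambda>m. entry (elementary i j a) p m * entry (elementary k l b) m q)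
      = (if p = i \<and> j = k \<and> q = l then a * b else 0)"
    by (simp only: Sum_any.delta)
  then show "entry (elementary i j a * elementary k l b) p q
      = entry (if j = k then elementary i l (a * b) else 0) p q"
    unfolding times_ut.rep_eq using ij kl by (auto simp: elementary.rep_eq zero_ut.rep_eq)
qed

lemma elementary_eq_0: "\<not> i \<le> j \<Longrightarrow> elementary i j (a :: 'a::ring) = 0"
  by (intro ut_eqI) (auto simp: elementary.rep_eq zero_ut.rep_eq)

lemma entry_sum: "entry (sum f A) i j = (\<Sum>x\<in>A. entry (f x) i j)"
  by (induction A rule: infinite_finite_induct) (simp_all add: zero_ut.rep_eq plus_ut.rep_eq)

lemma UT_component_mult:
  fixes M N :: "('i::order, 'a::ring_1) ut"
  assumes "M \<in> component (UT TYPE('i) TYPE('a)) (k, j)" and "N \<in> component (UT TYPE('i) TYPE('a)) (j', i)"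
  shows "M * N \<in> (if j = j' then component (UT TYPE('i) TYPE('a)) (k, i) else {0})"
proof -
  obtain a b where MN: "M = elementary k j a" "N = elementary j' i b"
    using assms by (auto simp: UT_def ut_component_def)
  have zero: "0 \<in> (ut_component (k, i) :: ('i, 'a) ut set)"
    by (simp add: ut_component_iff zero_ut.rep_eq)
  show ?thesis
  proof (cases "k \<le> j \<and> j' \<le> i")
    case True
    then show ?thesis
      by (auto simp: MN elementary_mult UT_def ut_component_def)
  next
    case False
    then have "M * N = 0"
      using elementary_eq_0[of k j a] elementary_eq_0[of j' i b] MN by auto
    with zero show ?thesis
      by (simp add: UT_def)
  qed
qed

lemma UT_local_one:
  fixes M :: "('i::order, 'a::ring_1) ut"
  assumes "M \<in> component (UT TYPE('i) TYPE('a)) (i, j)"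
  shows "local_one (UT TYPE('i) TYPE('a)) (i, i) \<in> component (UT TYPE('i) TYPE('a)) (i, i)"
    and "local_one (UT TYPE('i) TYPE('a)) (i, i) * M = M"
    and "M * local_one (UT TYPE('i) TYPE('a)) (j, j) = M"
proof -
  obtain a where M: "M = elementary i j a"
    using assms by (auto simp: UT_def ut_component_def)
  show "local_one (UT TYPE('i) TYPE('a)) (i, i) \<in> component (UT TYPE('i) TYPE('a)) (i, i)"
    by (auto simp: UT_def ut_component_def)
  show "local_one (UT TYPE('i) TYPE('a)) (i, i) * M = M"
    "M * local_one (UT TYPE('i) TYPE('a)) (j, j) = M"
    by (cases "i \<le> j"; simp add: M UT_def elementary_mult elementary_eq_0)+
qed

lemma UT_direct_sum:
  "internal_direct_sum (component (UT TYPE('i::order) TYPE('a::ring_1))) UNIV"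
proof -
  let ?S = "{f :: 'i \<times> 'i \<Rightarrow> ('i, 'a) ut. (\<forall>g. f g \<in> ut_component g) \<and> finite {g. f g \<noteq> 0}}"
  let ?s = "\<lambda>f :: 'i \<times> 'i \<Rightarrow> ('i, 'a) ut. \<Sum>g | f g \<noteq> 0. f g"
  have entry: "entry (?s f) i j = entry (f (i, j)) i j" if "f \<in> ?S" for f i j
  proof -
    have "entry (?s f) i j = (\<Sum>g | f g \<noteq> 0. if g = (i, j) then entry (f (i, j)) i j else 0)"
      unfolding entry_sum
    proof (intro sum.cong refl)
      fix g
      have "f g \<in> ut_component g"
        using that by blast
      then show "entry (f g) i j = (if g = (i, j) then entry (f (i, j)) i j else 0)"
        by (auto simp: ut_component_iff)
    qed
    also have "\<dots> = entry (f (i, j)) i j"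
      using that by (auto simp: zero_ut.rep_eq)
    finally show ?thesis .
  qed
  have "inj_on ?s ?S"
  proof (rule inj_onI)
    fix f h
    assume f: "f \<in> ?S" and h: "h \<in> ?S" and eq: "?s f = ?s h"
    have "entry (f g) k l = entry (h g) k l" for g k l
    proof (cases "g = (k, l)")
      case True
      then show ?thesis
        using entry[OF f, of k l] entry[OF h, of k l] eq by simp
    next
      case False
      have "f g \<in> ut_component g" "h g \<in> ut_component g"
        using f h by blast+
      with False show ?thesis
        by (auto simp: ut_component_iff)
    qed
    then show "f = h"
      by (intro ext ut_eqI)
  qed
  moreover have "M \<in> ?s ` ?S" for M :: "('i, 'a) ut"
  proof -
    define f where "f = (\<lambda>(i, j). elementary i j (entry M i j))"
    have "elementary i j 0 = (0 :: ('i, 'a) ut)" for i j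
      by (intro ut_eqI) (simp add: elementary.rep_eq zero_ut.rep_eq)
    then have "{g. f g \<noteq> 0} \<subseteq> {(i, j). entry M i j \<noteq> 0}"
      by (auto simp: f_def)
    then have f: "f \<in> ?S"
      using finite_subset[OF _ finite_entry] by (auto simp: f_def ut_component_def)
    have "?s f = M"
    proof (rule ut_eqI)
      fix i j
      show "entry (?s f) i j = entry M i j"
        unfolding entry[OF f] by (auto simp: f_def elementary.rep_eq entry_eq_0)
    qed
    with f show ?thesis
      by blast
  qed
  ultimately show ?thesis
    unfolding internal_direct_sum_def bij_betw_def by (auto simp: UT_def)
qed

end

theory Submission
  imports Defs
begin

text \<open>
  A graded right ideal is closed under left multiplication by the \<open>E\<^sub>i\<^sub>i\<close>, so a gr-maximal one is
  proper in a single row \<open>i\<close>; there it contains every strictly upper triangular entry and restricts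
  to a maximal right ideal of \<open>A\<close> on the diagonal. Hence the graded radical consists of the
  matrices with diagonal in the Jacobson radical \<open>J\<close> of \<open>A\<close>, which is nilpotent. A long product of
  such matrices vanishes in row \<open>i\<close> if only finitely many indices lie above \<open>i\<close> (by well-founded
  induction: either the path stays at \<open>i\<close> and picks up a power of \<open>J\<close>, or it moves up), whereas a
  chain \<open>i < k\<^sub>1 < \<dots> < k\<^sub>n\<close> gives a nonzero product of \<open>n\<close> elementary matrices.

  For the chain conditions, a graded left ideal inside column \<open>j\<close> is a family of left ideals of \<open>A\<close>
  that decreases along \<open>i \<le> j\<close>. Picking for each step of a descending chain an index where it is
  strict, and a nondecreasing subsequence of these indices, gives a descending chain in \<open>A\<close>.
\<close>


section \<open>Ideals and their powers\<close>

lemma group_closure_minimal: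
  assumes "0 \<in> H" and "\<And>x y. x \<in> H \<Longrightarrow> y \<in> H \<Longrightarrow> x - y \<in> H" and "S \<subseteq> H"
  shows "group_closure S \<subseteq> H"
proof
  fix x assume "x \<in> group_closure S"
  then show "x \<in> H"
    by induction (use assms in auto)
qed

text \<open>Applied with \<open>f\<close> a left or right multiplication; this is how facts about
  generating products pass to the finite sums of them that make up an ideal power.\<close>

lemma group_closure_additive_image:
  fixes f :: "'r::ring \<Rightarrow> 'r"
  assumes "x \<in> group_closure S" and "\<And>x y. f (x - y) = f x - f y"
    and "\<And>s. s \<in> S \<Longrightarrow> f s \<in> group_closure T"
  shows "f x \<in> group_closure T"
  using assms(1)
proof induction
  case (base s)
  have "f 0 = 0"
    using assms(2)[of 0 0] by simp
  then show ?case
    using base assms(3) by auto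
next
  case (diff s t)
  then show ?case
    by (simp add: assms(2) group_closure.diff)
qed

lemma diff_closed_imp_add_closed:
  fixes U :: "'r::group_add set"
  assumes "0 \<in> U" and "\<And>x y. x \<in> U \<Longrightarrow> y \<in> U \<Longrightarrow> x - y \<in> U" and "x \<in> U" and "y \<in> U"
  shows "x + y \<in> U"
proof -
  have "0 - y \<in> U"
    using assms by blast
  then have "x - (0 - y) \<in> U"
    using assms by blast
  then show ?thesis
    by simp
qed

lemma right_ideal_add: "right_ideal U \<Longrightarrow> x \<in> U \<Longrightarrow> y \<in> U \<Longrightarrow> x + y \<in> U"
  by (rule diff_closed_imp_add_closed) (auto simp: right_ideal_def)

lemma right_ideal_mult_left:
  assumes "right_ideal U"
  shows "right_ideal {x * u | u. u \<in> U}"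
  unfolding right_ideal_def
proof (intro conjI ballI allI)
  have "0 = x * 0" "0 \<in> U"
    using assms by (simp_all add: right_ideal_def)
  then show "0 \<in> {x * u | u. u \<in> U}"
    by blast
next
  fix y z assume "y \<in> {x * u | u. u \<in> U}" "z \<in> {x * u | u. u \<in> U}"
  then obtain u v where "u \<in> U" "v \<in> U" "y = x * u" "z = x * v"
    by blast
  then have "y - z = x * (u - v)" "u - v \<in> U"
    using assms by (auto simp: right_ideal_def algebra_simps)
  then show "y - z \<in> {x * u | u. u \<in> U}"
    by blast
next
  fix y r assume "y \<in> {x * u | u. u \<in> U}"
  then obtain u where "u \<in> U" "y = x * u"
    by blast
  then have "y * r = x * (u * r)" "u * r \<in> U"
    using assms by (auto simp: right_ideal_def algebra_simps)
  then show "y * r \<in> {x * u | u. u \<in> U}"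
    by blast
qed

lemma left_ideal_mult_right:
  assumes "left_ideal U"
  shows "left_ideal {u * x | u. u \<in> U}"
  unfolding left_ideal_def
proof (intro conjI ballI allI)
  have "0 = 0 * x" "0 \<in> U"
    using assms by (simp_all add: left_ideal_def)
  then show "0 \<in> {u * x | u. u \<in> U}"
    by blast
next
  fix y z assume "y \<in> {u * x | u. u \<in> U}" "z \<in> {u * x | u. u \<in> U}"
  then obtain u v where "u \<in> U" "v \<in> U" "y = u * x" "z = v * x"
    by blast
  then have "y - z = (u - v) * x" "u - v \<in> U"
    using assms by (auto simp: left_ideal_def algebra_simps)
  then show "y - z \<in> {u * x | u. u \<in> U}"
    by blast
next
  fix y r assume "y \<in> {u * x | u. u \<in> U}"
  then obtain u where "u \<in> U" "y = u * x"
    by blast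
  then have "r * y = (r * u) * x" "r * u \<in> U"
    using assms by (auto simp: left_ideal_def algebra_simps)
  then show "r * y \<in> {u * x | u. u \<in> U}"
    by blast
qed

lemma right_ideal_plus:
  fixes U V :: "'r::ring set"
  assumes "right_ideal U" and "right_ideal V"
  shows "right_ideal {u + v | u v. u \<in> U \<and> v \<in> V}"
  unfolding right_ideal_def
proof (intro conjI ballI allI)
  have "(0 :: 'r) = 0 + 0" "0 \<in> U" "0 \<in> V"
    using assms by (auto simp: right_ideal_def)
  then show "0 \<in> {u + v | u v. u \<in> U \<and> v \<in> V}"
    by blast
next
  fix y z assume "y \<in> {u + v | u v. u \<in> U \<and> v \<in> V}" "z \<in> {u + v | u v. u \<in> U \<and> v \<in> V}"
  then obtain u v u' v' where *: "u \<in> U" "v \<in> V" "y = u + v" "u' \<in> U" "v' \<in> V" "z = u' + v'"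
    by blast
  then have "y - z = (u - u') + (v - v')" "u - u' \<in> U" "v - v' \<in> V"
    using assms by (auto simp: right_ideal_def algebra_simps)
  then show "y - z \<in> {u + v | u v. u \<in> U \<and> v \<in> V}"
    by blast
next
  fix y r assume "y \<in> {u + v | u v. u \<in> U \<and> v \<in> V}"
  then obtain u v where "u \<in> U" "v \<in> V" "y = u + v"
    by blast
  then have "y * r = u * r + v * r" "u * r \<in> U" "v * r \<in> V"
    using assms by (auto simp: right_ideal_def algebra_simps)
  then show "y * r \<in> {u + v | u v. u \<in> U \<and> v \<in> V}"
    by blast
qed

text \<open>At \<open>n = 0\<close> the equation can fail, since the zeroth power is
  \<open>UNIV\<close> by convention; hence the positivity conditions on exponents below.\<close>

lemma ideal_power_Suc:
  "n > 0 \<Longrightarrow> ideal_power U (Suc n) = group_closure {x * y | x y. x \<in> ideal_power U n \<and> y \<in> U}"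
  by (cases n) auto

lemma mult_in_ideal_power_Suc:
  "n > 0 \<Longrightarrow> x \<in> ideal_power U n \<Longrightarrow> y \<in> U \<Longrightarrow> x * y \<in> ideal_power U (Suc n)"
  by (auto simp: ideal_power_Suc intro: group_closure.base)

lemma right_ideal_ideal_power:
  assumes "right_ideal U"
  shows "right_ideal (ideal_power U n)"
proof (induction n)
  case (Suc n)
  show ?case
  proof (cases "n = 0")
    case False
    have "x * r \<in> ideal_power U (Suc n)" if "x \<in> ideal_power U (Suc n)" for x r
      using that unfolding ideal_power_Suc[OF False[unfolded neq0_conv]]
    proof (rule group_closure_additive_image)
      fix s assume "s \<in> {x * y |x y. x \<in> ideal_power U n \<and> y \<in> U}"
      then obtain x y where "s = x * y" "x \<in> ideal_power U n" "y \<in> U"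
        by blast
      then have "s * r = x * (y * r)" "x \<in> ideal_power U n" "y * r \<in> U"
        using assms by (auto simp: right_ideal_def mult.assoc)
      then show "s * r \<in> group_closure {x * y |x y. x \<in> ideal_power U n \<and> y \<in> U}"
        by (auto intro: group_closure.base)
    qed (simp add: algebra_simps)
    then show ?thesis
      using False by (auto simp: right_ideal_def ideal_power_Suc intro: group_closure.diff)
  qed (use assms in simp)
qed (simp add: right_ideal_def)

text \<open>New factors are appended on the right, so a multiplier from the left meets the smaller
  power and the induction hypothesis absorbs it; in the right-handed version the multiplier is
  absorbed by the last factor, which lies in \<open>U\<close> itself.\<close>

lemma left_ideal_ideal_power:
  assumes "left_ideal U"
  shows "left_ideal (ideal_power U n)"
proof (induction n)
  case (Suc n)
  show ?case
  proof (cases "n = 0")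
    case False
    have "r * x \<in> ideal_power U (Suc n)" if "x \<in> ideal_power U (Suc n)" for x r
      using that unfolding ideal_power_Suc[OF False[unfolded neq0_conv]]
    proof (rule group_closure_additive_image)
      fix s assume "s \<in> {x * y |x y. x \<in> ideal_power U n \<and> y \<in> U}"
      then obtain x y where "s = x * y" "x \<in> ideal_power U n" "y \<in> U"
        by blast
      then have "r * s = (r * x) * y" "r * x \<in> ideal_power U n" "y \<in> U"
        using Suc.IH by (auto simp: left_ideal_def mult.assoc)
      then show "r * s \<in> group_closure {x * y |x y. x \<in> ideal_power U n \<and> y \<in> U}"
        by (auto intro: group_closure.base)
    qed (simp add: algebra_simps)
    then show ?thesis
      using False by (auto simp: left_ideal_def ideal_power_Suc intro: group_closure.diff)
  qed (use assms in simp)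
qed (simp add: left_ideal_def)

text \<open>Appending a factor from \<open>U\<close> is a special case of right multiplication by a
  ring element, under which the smaller power is closed.\<close>

lemma ideal_power_antimono:
  assumes "right_ideal U" and "m \<le> n"
  shows "ideal_power U n \<subseteq> ideal_power U m"
proof (rule lift_Suc_antimono_le[OF _ assms(2)])
  fix n
  show "ideal_power U (Suc n) \<subseteq> ideal_power U n"
  proof (cases "n = 0")
    case False
    have "right_ideal (ideal_power U n)"
      by (rule right_ideal_ideal_power[OF assms(1)])
    then show ?thesis
      unfolding ideal_power_Suc[OF False[unfolded neq0_conv]]
      by (intro group_closure_minimal) (auto simp: right_ideal_def)
  qed simp
qed

text \<open>Cuts a long product into a block of \<open>m\<close> factors followed by a block of
  \<open>n\<close>; later the two blocks are made to vanish for different reasons.\<close>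

lemma ideal_power_add:
  assumes "m > 0" and "n > 0"
  shows "ideal_power U (m + n) \<subseteq> group_closure {x * y | x y. x \<in> ideal_power U m \<and> y \<in> ideal_power U n}"
  using assms(2)
proof (induction n rule: nat_induct_non_zero)
  case 1
  then show ?case
    using assms by (simp add: ideal_power_Suc)
next
  case (Suc n)
  let ?P = "\<lambda>n. group_closure {x * y | x y. x \<in> ideal_power U m \<and> y \<in> ideal_power U n}"
  have "ideal_power U (Suc (m + n)) \<subseteq> ?P (Suc n)"
    unfolding ideal_power_Suc[OF add_pos_pos[OF assms(1) Suc.hyps]]
  proof (rule group_closure_minimal, safe)
    fix x y assume "x \<in> ideal_power U (m + n)" and y: "y \<in> U"
    then have "x \<in> ?P n"
      using Suc.IH by blast
    then show "x * y \<in> ?P (Suc n)"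
    proof (rule group_closure_additive_image)
      fix s assume "s \<in> {x * y |x y. x \<in> ideal_power U m \<and> y \<in> ideal_power U n}"
      then obtain p q where "s = p * q" "p \<in> ideal_power U m" "q \<in> ideal_power U n"
        by blast
      then have "s * y = p * (q * y)" "p \<in> ideal_power U m" "q * y \<in> ideal_power U (Suc n)"
        using y Suc.hyps by (auto simp: mult.assoc mult_in_ideal_power_Suc)
      then show "s * y \<in> ?P (Suc n)"
        by (auto intro: group_closure.base)
    qed (simp add: algebra_simps)
  qed (auto intro: group_closure.diff)
  then show ?case
    by simp
qed


section \<open>The Jacobson radical of a one-sided artinian ring\<close>

definition maximal_right_ideal :: "'a::ring set \<Rightarrow> bool" where
  "maximal_right_ideal M \<longleftrightarrow> right_ideal M \<and> M \<noteq> UNIV \<and>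
     (\<forall>N. right_ideal N \<longrightarrow> N \<noteq> UNIV \<longrightarrow> M \<subseteq> N \<longrightarrow> N = M)"

text \<open>Right ideals are used because \<open>rad_gr\<close> is an intersection of right ideals.
  Left-handed properties are recovered from the invertibility criterion
  \<open>jacobson_iff\<close>.\<close>

definition jacobson :: "'a::ring set" where
  "jacobson = \<Inter> {M. maximal_right_ideal M}"

lemma right_ideal_jacobson: "right_ideal jacobson"
  by (auto simp: jacobson_def maximal_right_ideal_def right_ideal_def)

lemma right_ideal_UNIV_iff: "right_ideal (U :: 'a::ring_1 set) \<Longrightarrow> U = UNIV \<longleftrightarrow> 1 \<in> U"
  unfolding right_ideal_def by (metis UNIV_I UNIV_eq_I mult_1)

text \<open>Zorn's lemma, with properness expressed by \<open>1 \<notin> V\<close>, a condition that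
  survives unions of chains.\<close>

lemma proper_right_ideal_subset_maximal:
  fixes U :: "'a::ring_1 set"
  assumes "right_ideal U" and "1 \<notin> U"
  obtains M where "maximal_right_ideal M" and "U \<subseteq> M"
proof -
  let ?A = "{V. right_ideal V \<and> 1 \<notin> V \<and> U \<subseteq> V}"
  have "\<exists>M\<in>?A. \<forall>V\<in>?A. M \<subseteq> V \<longrightarrow> V = M"
  proof (rule subset_Zorn_nonempty)
    fix C assume ne: "C \<noteq> {}" and C: "subset.chain ?A C"
    have C1: "\<And>V. V \<in> C \<Longrightarrow> right_ideal V \<and> 1 \<notin> V \<and> U \<subseteq> V"
      and C2: "\<And>V W. V \<in> C \<Longrightarrow> W \<in> C \<Longrightarrow> V \<subseteq> W \<or> W \<subseteq> V"
      using C unfolding subset_chain_def by blast+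
    have "right_ideal (\<Union>C)"
      unfolding right_ideal_def
    proof (intro conjI ballI allI)
      show "0 \<in> \<Union>C"
        using ne C1 by (auto simp: right_ideal_def)
    next
      fix x y assume "x \<in> \<Union>C" "y \<in> \<Union>C"
      then obtain V where "V \<in> C" "x \<in> V" "y \<in> V"
        using C2 by blast
      then show "x - y \<in> \<Union>C"
        using C1 unfolding right_ideal_def by blast
    next
      fix x r assume "x \<in> \<Union>C"
      then show "x * r \<in> \<Union>C"
        using C1 unfolding right_ideal_def by blast
    qed
    then show "\<Union>C \<in> ?A"
      using ne C1 by blast
  qed (use assms in blast)
  then obtain M where M: "M \<in> ?A" and max: "\<forall>V\<in>?A. M \<subseteq> V \<longrightarrow> V = M"
    by (rule bexE)
  have "V = M" if "right_ideal V" "V \<noteq> UNIV" "M \<subseteq> V" for V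
  proof -
    have "V \<in> ?A"
      using that M right_ideal_UNIV_iff[of V] by auto
    then show ?thesis
      using max that(3) by blast
  qed
  with M show thesis
    using that[of M] by (auto simp: maximal_right_ideal_def)
qed

text \<open>If \<open>1 - x * a\<close> has no right inverse, it generates a proper right ideal; a
  maximal one above it also contains \<open>x * a\<close>, hence 1. Conversely, a maximal
  \<open>M\<close> missing \<open>x\<close> satisfies xA + M = A, so some \<open>1 - x * a\<close>
  lies in \<open>M\<close>, and its right inverse puts 1 into \<open>M\<close>.\<close>

lemma jacobson_iff: "(x :: 'a::ring_1) \<in> jacobson \<longleftrightarrow> (\<forall>a. \<exists>c. (1 - x * a) * c = 1)"
proof
  assume x: "x \<in> jacobson"
  show "\<forall>a. \<exists>c. (1 - x * a) * c = 1"
  proof (rule allI, rule ccontr)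
    fix a assume neg: "\<not> (\<exists>c. (1 - x * a) * c = 1)"
    have "right_ideal {(1 - x * a) * c | c. c \<in> UNIV}"
      by (rule right_ideal_mult_left) (simp add: right_ideal_def)
    moreover have "1 \<notin> {(1 - x * a) * c | c. c \<in> UNIV}"
    proof
      assume "1 \<in> {(1 - x * a) * c | c. c \<in> UNIV}"
      then obtain c where "1 = (1 - x * a) * c"
        by blast
      with neg show False
        by metis
    qed
    ultimately obtain M where M: "maximal_right_ideal M" "{(1 - x * a) * c | c. c \<in> UNIV} \<subseteq> M"
      by (rule proper_right_ideal_subset_maximal)
    have "(1 - x * a) * 1 \<in> M"
      using M(2) by blast
    moreover have "x * a \<in> M"
      using x M(1) by (auto simp: jacobson_def maximal_right_ideal_def right_ideal_def)
    ultimately have "(1 - x * a) + x * a \<in> M"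
      using M(1) right_ideal_add[of M "1 - x * a" "x * a"] by (simp add: maximal_right_ideal_def)
    then show False
      using M(1) right_ideal_UNIV_iff[of M] by (simp add: maximal_right_ideal_def)
  qed
next
  assume inv: "\<forall>a. \<exists>c. (1 - x * a) * c = 1"
  show "x \<in> jacobson"
    unfolding jacobson_def
  proof safe
    fix M :: "'a set" assume M: "maximal_right_ideal M"
    then have rM: "right_ideal M" "M \<noteq> UNIV"
      by (auto simp: maximal_right_ideal_def)
    show "x \<in> M"
    proof (rule ccontr)
      assume "x \<notin> M"
      let ?N = "{u + v | u v. u \<in> {x * a | a. a \<in> UNIV} \<and> v \<in> M}"
      have N: "right_ideal ?N"
        by (intro right_ideal_plus right_ideal_mult_left rM) (simp add: right_ideal_def)
      have "x * 1 + 0 \<in> ?N" and "\<And>v. v \<in> M \<Longrightarrow> x * 0 + v \<in> ?N"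
        using rM(1) unfolding right_ideal_def by blast+
      then have "x \<in> ?N" "M \<subseteq> ?N"
        by (simp_all add: subset_iff)
      then have "M \<subseteq> ?N" "?N \<noteq> M"
        using \<open>x \<notin> M\<close> by blast+
      then have "?N = UNIV"
        using M N unfolding maximal_right_ideal_def by blast
      then have "1 \<in> ?N"
        by blast
      then obtain a v where "1 = x * a + v" "v \<in> M"
        by blast
      then have "1 - x * a \<in> M"
        by (metis add_diff_cancel_left')
      moreover obtain c where "(1 - x * a) * c = 1"
        using inv by blast
      ultimately have "1 \<in> M"
        using rM(1) unfolding right_ideal_def by metis
      with rM right_ideal_UNIV_iff show False
        by blast
    qed
  qed
qed

text \<open>Right invertibility of \<open>1 - y * r\<close> carries over to
  \<open>1 - r * y\<close>, which makes the criterion \<open>jacobson_iff\<close> stable under left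
  multiplication.\<close>

lemma left_ideal_jacobson: "left_ideal (jacobson :: 'a::ring_1 set)"
  unfolding left_ideal_def
proof (intro conjI ballI allI)
  fix x r :: 'a assume x: "x \<in> jacobson"
  show "r * x \<in> jacobson"
    unfolding jacobson_iff
  proof
    fix a
    define y where "y = x * a"
    obtain d where d: "(1 - y * r) * d = 1"
      using x unfolding jacobson_iff y_def by (metis mult.assoc)
    \<comment> \<open>The candidate inverse comes from the formal geometric series: the sum of the
      powers of \<open>r * y\<close> is 1 plus \<open>r\<close> times the sum of the powers of
      \<open>y * r\<close> times \<open>y\<close>, and \<open>d\<close> stands for that inner
      sum.\<close>
    have "(1 - r * y) * (1 + r * d * y) = 1 - r * y + r * ((1 - y * r) * d) * y"
      by (simp add: algebra_simps)
    then have "(1 - r * x * a) * (1 + r * d * y) = 1"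
      by (simp add: d) (simp add: y_def mult.assoc)
    then show "\<exists>c. (1 - r * x * a) * c = 1"
      by blast
  qed
qed (use right_ideal_jacobson in \<open>auto simp: right_ideal_def\<close>)

text \<open>The right inverse \<open>c\<close> equals \<open>1 - b * (- c)\<close>, so
  \<open>c\<close> has a right inverse as well. Having the left inverse \<open>1 - b\<close> too,
  \<open>c\<close> is a unit.\<close>

lemma one_minus_jacobson_unit:
  assumes "(b :: 'a::ring_1) \<in> jacobson"
  obtains c where "(1 - b) * c = 1" and "c * (1 - b) = 1"
proof -
  obtain c where c: "(1 - b) * c = 1"
    using assms unfolding jacobson_iff by (metis mult_1_right)
  then have c': "c = 1 - b * (- c)"
    by (simp add: algebra_simps)
  obtain d where d: "c * d = 1"
    using assms c' unfolding jacobson_iff by metis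
  have "1 - b = (1 - b) * (c * d)"
    by (simp add: d)
  then have "1 - b = d"
    by (simp add: c flip: mult.assoc)
  with c d that show thesis
    by blast
qed

section \<open>Nilpotency of the Jacobson radical under either chain condition\<close>

lemma right_artinian_minimal:
  fixes F :: "'a::ring_1 set set"
  assumes "right_artinian TYPE('a)" and "F \<noteq> {}" and "\<And>U. U \<in> F \<Longrightarrow> right_ideal U"
  obtains M where "M \<in> F" and "\<And>U. U \<in> F \<Longrightarrow> \<not> U \<subset> M"
proof -
  \<comment> \<open>Both members of a pair are required to be right ideals, so that an infinite
    descending chain is exactly what \<open>right_artinian\<close> excludes.\<close>
  have "wf {(V, U :: 'a set). right_ideal V \<and> right_ideal U \<and> V \<subset> U}"
    using assms(1) unfolding wf_iff_no_infinite_down_chain right_artinian_def by blast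
  then have "\<exists>M\<in>F. \<forall>V. (V, M) \<in> {(V, U). right_ideal V \<and> right_ideal U \<and> V \<subset> U} \<longrightarrow> V \<notin> F"
    using assms(2) unfolding wf_eq_minimal by blast
  then show thesis
    using assms(3) that by blast
qed

lemma left_artinian_minimal:
  fixes F :: "'a::ring_1 set set"
  assumes "left_artinian TYPE('a)" and "F \<noteq> {}" and "\<And>U. U \<in> F \<Longrightarrow> left_ideal U"
  obtains M where "M \<in> F" and "\<And>U. U \<in> F \<Longrightarrow> \<not> U \<subset> M"
proof -
  have "wf {(V, U :: 'a set). left_ideal V \<and> left_ideal U \<and> V \<subset> U}"
    using assms(1) unfolding wf_iff_no_infinite_down_chain left_artinian_def by blast
  then have "\<exists>M\<in>F. \<forall>V. (V, M) \<in> {(V, U). left_ideal V \<and> left_ideal U \<and> V \<subset> U} \<longrightarrow> V \<notin> F"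
    using assms(2) unfolding wf_eq_minimal by blast
  then show thesis
    using assms(3) that by blast
qed

text \<open>If \<open>B\<close> is nonzero, take a minimal right ideal \<open>K\<close> with KB
  nonzero, and \<open>k\<close> in \<open>K\<close> not annihilating \<open>B\<close>. Idempotency
  keeps kBB nonzero, so minimality gives kB = K and \<open>k = k * b\<close> for some
  \<open>b\<close> in \<open>B\<close>; as \<open>1 - b\<close> is invertible,
  \<open>k = 0\<close>.\<close>

lemma right_ideal_stable_imp_zero:
  fixes B :: "'a::ring_1 set"
  assumes art: "right_artinian TYPE('a)" and B: "right_ideal B" "B \<subseteq> jacobson"
    and idem: "B \<subseteq> group_closure {x * y | x y. x \<in> B \<and> y \<in> B}"
  shows "B = {0}"
proof (rule ccontr)
  assume "B \<noteq> {0}"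
  moreover have B0: "0 \<in> B"
    using B by (simp add: right_ideal_def)
  ultimately obtain b0 where "b0 \<in> B" "b0 \<noteq> 0"
    by blast
  let ?F = "{K. right_ideal K \<and> (\<exists>k\<in>K. \<exists>b\<in>B. k * b \<noteq> 0)}"
  have "1 * b0 \<noteq> 0"
    using \<open>b0 \<noteq> 0\<close> by simp
  moreover have "right_ideal (UNIV :: 'a set)"
    by (simp add: right_ideal_def)
  ultimately have "UNIV \<in> ?F"
    using \<open>b0 \<in> B\<close> by blast
  then have "?F \<noteq> {}"
    by blast
  then obtain K where K: "K \<in> ?F" and min: "\<And>U. U \<in> ?F \<Longrightarrow> \<not> U \<subset> K"
    by (rule right_artinian_minimal[OF art]) auto
  then obtain k b1 where k: "k \<in> K" "b1 \<in> B" "k * b1 \<noteq> 0"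
    by blast
  let ?kB = "{k * b | b. b \<in> B}"
  \<comment> \<open>The elements annihilated by \<open>k\<close> form an additive group. If it
    contained all products of two elements of \<open>B\<close>, it would contain \<open>B\<close> by
    \<open>idem\<close>, against the choice of \<open>k\<close>.\<close>
  have "\<exists>b\<in>B. \<exists>b'\<in>B. k * b * b' \<noteq> 0"
  proof (rule ccontr)
    assume "\<not> ?thesis"
    then have "group_closure {x * y | x y. x \<in> B \<and> y \<in> B} \<subseteq> {x. k * x = 0}"
      by (intro group_closure_minimal) (auto simp: algebra_simps)
    with idem k show False
      by blast
  qed
  then have "?kB \<in> ?F"
    using right_ideal_mult_left[OF B(1)] by blast
  moreover have "?kB \<subseteq> K"
    using K k(1) by (auto simp: right_ideal_def)
  ultimately have "?kB = K"
    using min by blast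
  with k(1) obtain b where b: "b \<in> B" "k * b = k"
    by force
  obtain c where "(1 - b) * c = 1"
    using one_minus_jacobson_unit b(1) B(2) by blast
  then have "k = k * ((1 - b) * c)"
    by simp
  also have "\<dots> = (k - k * b) * c"
    by (simp add: algebra_simps)
  also have "\<dots> = 0"
    by (simp add: b(2))
  finally have "k = 0" .
  with k(3) show False
    by simp
qed

text \<open>Mirror image with left ideals \<open>K\<close> such that BK is nonzero. The last step
  now cancels \<open>1 - b\<close> on the left, which is why a two-sided inverse was
  established.\<close>

lemma left_ideal_stable_imp_zero:
  fixes B :: "'a::ring_1 set"
  assumes art: "left_artinian TYPE('a)" and B: "left_ideal B" "B \<subseteq> jacobson"
    and idem: "B \<subseteq> group_closure {x * y | x y. x \<in> B \<and> y \<in> B}"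
  shows "B = {0}"
proof (rule ccontr)
  assume "B \<noteq> {0}"
  moreover have B0: "0 \<in> B"
    using B by (simp add: left_ideal_def)
  ultimately obtain b0 where "b0 \<in> B" "b0 \<noteq> 0"
    by blast
  let ?F = "{K. left_ideal K \<and> (\<exists>k\<in>K. \<exists>b\<in>B. b * k \<noteq> 0)}"
  have "b0 * 1 \<noteq> 0"
    using \<open>b0 \<noteq> 0\<close> by simp
  moreover have "left_ideal (UNIV :: 'a set)"
    by (simp add: left_ideal_def)
  ultimately have "UNIV \<in> ?F"
    using \<open>b0 \<in> B\<close> by blast
  then have "?F \<noteq> {}"
    by blast
  then obtain K where K: "K \<in> ?F" and min: "\<And>U. U \<in> ?F \<Longrightarrow> \<not> U \<subset> K"
    by (rule left_artinian_minimal[OF art]) auto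
  then obtain k b1 where k: "k \<in> K" "b1 \<in> B" "b1 * k \<noteq> 0"
    by blast
  let ?Bk = "{b * k | b. b \<in> B}"
  have "\<exists>b\<in>B. \<exists>b'\<in>B. b' * (b * k) \<noteq> 0"
  proof (rule ccontr)
    assume "\<not> ?thesis"
    then have "group_closure {x * y | x y. x \<in> B \<and> y \<in> B} \<subseteq> {x. x * k = 0}"
      by (intro group_closure_minimal) (auto simp: algebra_simps)
    with idem k show False
      by blast
  qed
  then have "?Bk \<in> ?F"
    using left_ideal_mult_right[OF B(1)] by blast
  moreover have "?Bk \<subseteq> K"
    using K k(1) by (auto simp: left_ideal_def)
  ultimately have "?Bk = K"
    using min by blast
  with k(1) obtain b where b: "b \<in> B" "b * k = k"
    by force
  obtain c where "c * (1 - b) = 1"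
    using one_minus_jacobson_unit b(1) B(2) by blast
  then have "k = (c * (1 - b)) * k"
    by simp
  also have "\<dots> = c * (k - b * k)"
    by (simp add: algebra_simps)
  also have "\<dots> = 0"
    by (simp add: b(2))
  finally have "k = 0" .
  with k(3) show False
    by simp
qed

text \<open>Minimality forces the power with exponent \<open>n + n\<close> to equal the one with
  exponent \<open>n\<close>, and the former splits into two blocks of length
  \<open>n\<close>.\<close>

lemma ideal_power_stable_idem:
  assumes "right_ideal U" and "n > 0" and "\<And>m. \<not> ideal_power U m \<subset> ideal_power U n"
  shows "ideal_power U n \<subseteq> group_closure {x * y | x y. x \<in> ideal_power U n \<and> y \<in> ideal_power U n}"
proof -
  have "ideal_power U (n + n) = ideal_power U n"
    using ideal_power_antimono[OF assms(1), of n "n + n"] assms(3)[of "n + n"] by auto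
  with ideal_power_add[OF assms(2,2), of U] show ?thesis
    by (simp only:)
qed

text \<open>All positive powers of the radical are two-sided ideals, so a chain condition on either
  side yields a minimal one, which is idempotent and therefore zero.\<close>

lemma jacobson_nilpotent:
  assumes "right_artinian TYPE('a::ring_1) \<or> left_artinian TYPE('a)"
  obtains n where "n > 0" and "ideal_power (jacobson :: 'a::ring_1 set) n = {0}"
proof -
  let ?J = "jacobson :: 'a set"
  define F where "F = {ideal_power ?J n | n. n > 0}"
  have ne: "F \<noteq> {}"
    by (auto simp: F_def)
  have ideals: "right_ideal V" "left_ideal V" if V: "V \<in> F" for V
  proof -
    obtain n where "V = ideal_power ?J n"
      using V by (auto simp: F_def)
    then show "right_ideal V" "left_ideal V"
      by (simp_all add: right_ideal_ideal_power right_ideal_jacobson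
          left_ideal_ideal_power left_ideal_jacobson)
  qed
  have "\<exists>B\<in>F. \<forall>V\<in>F. \<not> V \<subset> B"
    using assms
  proof
    assume "right_artinian TYPE('a)"
    then show ?thesis
      by (rule right_artinian_minimal[OF _ ne ideals(1)]) blast+
  next
    assume "left_artinian TYPE('a)"
    then show ?thesis
      by (rule left_artinian_minimal[OF _ ne ideals(2)]) blast+
  qed
  then obtain B where B: "B \<in> F" and min: "\<And>V. V \<in> F \<Longrightarrow> \<not> V \<subset> B"
    by blast
  then obtain n where n: "n > 0" "B = ideal_power ?J n"
    by (auto simp: F_def)
  \<comment> \<open>\<open>F\<close> holds only positive exponents; for \<open>m = 0\<close> the
    power is \<open>UNIV\<close>, which is a proper subset of nothing.\<close>
  have "\<not> ideal_power ?J m \<subset> ideal_power ?J n" for m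
  proof (cases "m = 0")
    case False
    then have "ideal_power ?J m \<in> F"
      by (auto simp: F_def)
    then show ?thesis
      using min n(2) by blast
  qed auto
  then have "B \<subseteq> group_closure {x * y | x y. x \<in> B \<and> y \<in> B}"
    unfolding n(2) by (rule ideal_power_stable_idem[OF right_ideal_jacobson n(1)])
  moreover have "B \<subseteq> ?J"
    using ideal_power_antimono[OF right_ideal_jacobson, of 1 n] n by simp
  ultimately have "B = {0}"
    using assms ideals[OF B] right_ideal_stable_imp_zero left_ideal_stable_imp_zero by blast
  with n that show thesis
    by blast
qed


section \<open>Graded right ideals of upper triangular matrices\<close>

lemma entry_elementary_mult:
  "entry (elementary i j a * X) p q = (if p = i \<and> i \<le> j then (a :: 'a::ring) * entry X j q else 0)"
proof -
  have "(\<lambda>m. entry (elementary i j a) p m * entry X m q)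
      = (\<lambda>m. if m = j then (if p = i \<and> i \<le> j then a * entry X j q else 0) else 0)"
    by (auto simp: elementary.rep_eq fun_eq_iff)
  then show ?thesis
    by (simp only: times_ut.rep_eq Sum_any.delta)
qed

lemma entry_mult_elementary:
  "entry (X * elementary i j a) p q = (if q = j \<and> i \<le> j then entry X p i * (a :: 'a::ring) else 0)"
proof -
  have "(\<lambda>m. entry X p m * entry (elementary i j a) m q)
      = (\<lambda>m. if m = i then (if q = j \<and> i \<le> j then entry X p i * a else 0) else 0)"
    by (auto simp: elementary.rep_eq fun_eq_iff)
  then show ?thesis
    by (simp only: times_ut.rep_eq Sum_any.delta)
qed

text \<open>A summand can be nonzero only if \<open>i \<le> m\<close> and \<open>m \<le> i\<close>,
  which leaves \<open>m = i\<close>.\<close>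

lemma entry_mult_diag: "entry (X * Y) i i = entry X i i * (entry Y i i :: 'a::ring)"
proof -
  have "(\<lambda>m. entry X i m * entry Y m i) = (\<lambda>m. if m = i then entry X i i * entry Y i i else 0)"
  proof
    fix m
    show "entry X i m * entry Y m i = (if m = i then entry X i i * entry Y i i else 0)"
      using entry_eq_0[of i m X] entry_eq_0[of m i Y] by (cases "i \<le> m"; cases "m \<le> i") auto
  qed
  then show ?thesis
    by (simp only: times_ut.rep_eq Sum_any.delta)
qed

lemma entry_minus: "entry (X - Y) i j = entry X i j - (entry Y i j :: 'a::ring)"
  unfolding minus_ut_def plus_ut.rep_eq uminus_ut.rep_eq by simp

lemmas entry_simps = zero_ut.rep_eq plus_ut.rep_eq entry_minus elementary.rep_eq
  entry_elementary_mult entry_mult_elementary entry_mult_diag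

lemma elementary_0: "elementary i j (0 :: 'a::ring) = 0"
  by (intro ut_eqI) (simp add: entry_simps)

lemma elementary_diff: "elementary i j (a - b :: 'a::ring) = elementary i j a - elementary i j b"
  by (intro ut_eqI) (simp add: entry_simps)

text \<open>Turns the extraction of a homogeneous component into multiplications, so that ideal
  closure can be used to prove gradedness and conversely.\<close>

lemma elementary_part:
  "elementary i j (entry X i j) = elementary i i 1 * X * elementary j j (1 :: 'a::ring_1)"
  by (intro ut_eqI) (use entry_eq_0[of i j X] in \<open>auto simp: entry_simps\<close>)

lemma ut_eq_sum_parts:
  fixes X :: "('i::order, 'a::ring) ut"
  shows "X = (\<Sum>(i, j) | entry X i j \<noteq> 0. elementary i j (entry X i j))"
proof (rule ut_eqI)
  fix p q
  have "entry (\<Sum>(i, j) | entry X i j \<noteq> 0. elementary i j (entry X i j)) p q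
      = (\<Sum>g\<in>{(i, j). entry X i j \<noteq> 0}. if g = (p, q) then entry X p q else 0)"
    unfolding entry_sum
    by (intro sum.cong refl) (use entry_eq_0[of p q X] in \<open>auto simp: elementary.rep_eq split: if_splits\<close>)
  also have "\<dots> = entry X p q"
    using finite_entry[of X] by simp
  finally show "entry X p q = entry (\<Sum>(i, j) | entry X i j \<noteq> 0. elementary i j (entry X i j)) p q"
    by simp
qed

lemma sum_mem_if_diff_closed:
  fixes U :: "'r::ring set"
  assumes "0 \<in> U" and "\<And>x y. x \<in> U \<Longrightarrow> y \<in> U \<Longrightarrow> x - y \<in> U" and "\<And>x. x \<in> A \<Longrightarrow> f x \<in> U"
  shows "sum f A \<in> U"
  using assms(3)
proof (induction A rule: infinite_finite_induct)
  case (insert x A)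
  then have "f x + sum f A \<in> U"
    by (intro diff_closed_imp_add_closed[OF assms(1,2)]) auto
  with insert show ?case
    by simp
qed (use assms in auto)

lemma mem_if_parts_mem:
  fixes X :: "('i::order, 'a::ring) ut"
  assumes "0 \<in> U" and "\<And>x y. x \<in> U \<Longrightarrow> y \<in> U \<Longrightarrow> x - y \<in> U"
    and "\<And>i j. elementary i j (entry X i j) \<in> U"
  shows "X \<in> U"
  by (subst ut_eq_sum_parts, rule sum_mem_if_diff_closed) (use assms in auto)

lemma entry_sum_components:
  fixes f :: "'i::order \<times> 'i \<Rightarrow> ('i, 'a::ring) ut"
  assumes "\<And>g. f g \<in> ut_component g" and "finite {g. f g \<noteq> 0}"
  shows "entry (\<Sum>g | f g \<noteq> 0. f g) i j = entry (f (i, j)) i j"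
proof -
  have "entry (\<Sum>g | f g \<noteq> 0. f g) i j
      = (\<Sum>g | f g \<noteq> 0. if g = (i, j) then entry (f (i, j)) i j else 0)"
    unfolding entry_sum
  proof (intro sum.cong refl)
    fix g
    show "entry (f g) i j = (if g = (i, j) then entry (f (i, j)) i j else 0)"
      using assms(1)[of g] by (auto simp: ut_component_iff)
  qed
  also have "\<dots> = entry (f (i, j)) i j"
    using assms(2) by (auto simp: zero_ut.rep_eq)
  finally show ?thesis .
qed

text \<open>Injectivity of the sum map is inherited from the decomposition of the whole ring, and
  its values stay in the additive group \<open>U\<close>. What remains is surjectivity: the
  components of each element of \<open>U\<close> lie in \<open>U\<close>.\<close>

lemma graded_subset_UT_iff:
  fixes U :: "('i::order, 'a::ring_1) ut set"
  assumes "0 \<in> U" and diff: "\<And>x y. x \<in> U \<Longrightarrow> y \<in> U \<Longrightarrow> x - y \<in> U"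
  shows "graded_subset (UT TYPE('i) TYPE('a)) U \<longleftrightarrow> (\<forall>X\<in>U. \<forall>i j. elementary i j (entry X i j) \<in> U)"
proof -
  let ?S = "{f :: 'i \<times> 'i \<Rightarrow> ('i, 'a) ut. (\<forall>g. f g \<in> ut_component g) \<and> finite {g. f g \<noteq> 0}}"
  let ?T = "{f. (\<forall>g. f g \<in> U \<inter> ut_component g) \<and> finite {g. f g \<noteq> 0}}"
  let ?s = "\<lambda>f :: 'i \<times> 'i \<Rightarrow> ('i, 'a) ut. \<Sum>g | f g \<noteq> 0. f g"
  have "inj_on ?s ?S"
    using UT_direct_sum[where 'i = 'i and 'a = 'a]
    unfolding internal_direct_sum_def bij_betw_def UT_def by simp
  then have inj: "inj_on ?s ?T"
    by (rule inj_on_subset) auto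
  have "?s f \<in> U" if "f \<in> ?T" for f
    by (rule sum_mem_if_diff_closed) (use that assms in auto)
  then have sub: "?s ` ?T \<subseteq> U"
    by blast
  have "graded_subset (UT TYPE('i) TYPE('a)) U \<longleftrightarrow> U \<subseteq> ?s ` ?T"
    unfolding graded_subset_def internal_direct_sum_def bij_betw_def UT_def using inj sub by auto
  also have "\<dots> \<longleftrightarrow> (\<forall>X\<in>U. \<forall>i j. elementary i j (entry X i j) \<in> U)"
  proof (intro iffI ballI allI subsetI)
    fix X i j assume "U \<subseteq> ?s ` ?T" "X \<in> U"
    then obtain f where f: "X = ?s f" "\<And>g. f g \<in> U" "\<And>g. f g \<in> ut_component g" "finite {g. f g \<noteq> 0}"
      by blast
    have "elementary i j (entry X i j) = f (i, j)"
      unfolding f(1) entry_sum_components[OF f(3,4)]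
      using f(3)[of "(i, j)"] by (auto simp: ut_component_def elementary.rep_eq elementary_eq_0 entry_simps)
    with f(2) show "elementary i j (entry X i j) \<in> U"
      by simp
  next
    fix X assume X: "\<forall>X\<in>U. \<forall>i j. elementary i j (entry X i j) \<in> U" "X \<in> U"
    define f where "f = (\<lambda>(i, j). elementary i j (entry X i j))"
    have "{g. f g \<noteq> 0} \<subseteq> {(i, j). entry X i j \<noteq> 0}"
      by (auto simp: f_def elementary_0)
    then have fin: "finite {g. f g \<noteq> 0}"
      using finite_entry finite_subset by blast
    moreover have comp: "f g \<in> ut_component g" for g
      by (auto simp: f_def ut_component_def split: prod.split)
    moreover have "f g \<in> U" for g
      using X by (auto simp: f_def split: prod.split)
    ultimately have "f \<in> ?T"
      by simp
    moreover have "X = ?s f"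
    proof (rule ut_eqI)
      fix i j
      show "entry X i j = entry (?s f) i j"
        unfolding entry_sum_components[OF comp fin] by (auto simp: f_def elementary.rep_eq entry_eq_0)
    qed
    ultimately show "X \<in> ?s ` ?T"
      by blast
  qed
  finally show ?thesis .
qed

text \<open>In the product \<open>elementary_part\<close> the right-hand factor is absorbed by a
  right ideal, so only the left multiplications have to be demanded.\<close>

lemma graded_right_ideal_UT_iff:
  fixes U :: "('i::order, 'a::ring_1) ut set"
  shows "graded_right_ideal (UT TYPE('i) TYPE('a)) U \<longleftrightarrow>
    right_ideal U \<and> (\<forall>X\<in>U. \<forall>i. elementary i i 1 * X \<in> U)"
proof (cases "right_ideal U")
  case True
  then have *: "0 \<in> U" "\<And>x y. x \<in> U \<Longrightarrow> y \<in> U \<Longrightarrow> x - y \<in> U" "\<And>x r. x \<in> U \<Longrightarrow> x * r \<in> U"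
    by (auto simp: right_ideal_def)
  have parts_iff: "graded_subset (UT TYPE('i) TYPE('a)) U \<longleftrightarrow>
      (\<forall>X\<in>U. \<forall>i j. elementary i j (entry X i j) \<in> U)"
    by (rule graded_subset_UT_iff) (use *(1,2) in auto)
  have "graded_subset (UT TYPE('i) TYPE('a)) U \<longleftrightarrow> (\<forall>X\<in>U. \<forall>i. elementary i i 1 * X \<in> U)"
    unfolding parts_iff
  proof (intro iffI ballI allI)
    fix X i assume "\<forall>X\<in>U. \<forall>i j. elementary i j (entry X i j) \<in> U" "X \<in> U"
    then have parts: "elementary p q (entry (elementary i i 1 * X) p q) \<in> U" for p q
      using *(1) by (auto simp: entry_simps elementary_0)
    show "elementary i i 1 * X \<in> U"
      by (rule mem_if_parts_mem[OF *(1,2) parts])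
  next
    fix X i j assume "\<forall>X\<in>U. \<forall>i. elementary i i 1 * X \<in> U" "X \<in> U"
    then show "elementary i j (entry X i j) \<in> U"
      unfolding elementary_part using *(3) by blast
  qed
  with True show ?thesis
    by (simp add: graded_right_ideal_def)
qed (simp add: graded_right_ideal_def)


section \<open>The graded radical of upper triangular matrices\<close>

text \<open>A larger graded right ideal \<open>N\<close> contains some
  \<open>elementary i i a\<close> with \<open>a\<close> outside \<open>m\<close>. Its trace at
  position (i, i) is then all of the base ring, so \<open>N\<close> contains row \<open>i\<close>;
  everything with zero row \<open>i\<close> is in it anyway.\<close>

lemma gr_maximal_right_ideal_diag:
  fixes m :: "'a::ring_1 set" and i :: "'i::order"
  assumes "maximal_right_ideal m"
  shows "gr_maximal_right_ideal (UT TYPE('i) TYPE('a)) {X. entry X i i \<in> m}"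
    (is "gr_maximal_right_ideal _ ?M")
proof -
  have m: "right_ideal m" "1 \<notin> m" "0 \<in> m"
    using assms right_ideal_UNIV_iff by (auto simp: maximal_right_ideal_def right_ideal_def)
  have M: "graded_right_ideal (UT TYPE('i) TYPE('a)) ?M"
    using m(1) unfolding graded_right_ideal_UT_iff by (auto simp: right_ideal_def entry_simps)
  have "elementary i i 1 \<notin> ?M"
    using m(2) by (simp add: entry_simps)
  then have ne: "?M \<noteq> UNIV"
    by blast
  have "N = UNIV" if N: "graded_right_ideal (UT TYPE('i) TYPE('a)) N" and sub: "?M \<subset> N" for N
  proof -
    have rN: "right_ideal N" and gN: "\<And>X k. X \<in> N \<Longrightarrow> elementary k k 1 * X \<in> N"
      using N by (auto simp: graded_right_ideal_UT_iff)
    define n where "n = {a. elementary i i a \<in> N}"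
    have mult: "elementary i i (a * r) = elementary i i a * elementary i i r" for a r :: 'a
      by (simp add: elementary_mult)
    have "right_ideal n"
      using rN by (auto simp: n_def right_ideal_def elementary_0 elementary_diff mult)
    moreover have "m \<subseteq> n"
      using sub by (auto simp: n_def entry_simps)
    moreover have "\<exists>a. a \<in> n \<and> a \<notin> m"
    proof -
      obtain X where X: "X \<in> N" "entry X i i \<notin> m"
        using sub by blast
      have "elementary i i (entry X i i) \<in> N"
        unfolding elementary_part using gN[OF X(1)] rN by (auto simp: right_ideal_def)
      with X(2) show ?thesis
        by (auto simp: n_def)
    qed
    ultimately have "n = UNIV"
      using assms unfolding maximal_right_ideal_def by blast
    then have one: "elementary i i 1 \<in> N"
      by (auto simp: n_def)
    have "Y \<in> N" for Y
    proof -
      have "elementary i i 1 * Y \<in> N"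
        using one rN by (auto simp: right_ideal_def)
      \<comment> \<open>This difference has zero row \<open>i\<close>, so its (i, i) entry is
        \<open>0\<close>, an element of \<open>m\<close>.\<close>
      moreover have "Y - elementary i i 1 * Y \<in> N"
        using m(3) by (intro psubset_imp_subset[OF sub, THEN subsetD]) (simp add: entry_simps)
      ultimately show ?thesis
        using right_ideal_add[OF rN, of "elementary i i 1 * Y" "Y - elementary i i 1 * Y"] by simp
    qed
    then show ?thesis
      by blast
  qed
  with M ne show ?thesis
    unfolding gr_maximal_right_ideal_def by blast
qed

text \<open>Each maximal right ideal of the base ring gives a gr-maximal one at position (i, i).
  This bounds the graded radical from above, as the nilpotency results require.\<close>

lemma entry_rad_gr_diag:
  assumes "X \<in> rad_gr (UT TYPE('i::order) TYPE('a::ring_1))"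
  shows "entry X i i \<in> jacobson"
  using assms gr_maximal_right_ideal_diag unfolding rad_gr_def jacobson_def by blast

lemma right_ideal_rad_gr: "right_ideal (rad_gr R)"
  by (auto simp: rad_gr_def gr_maximal_right_ideal_def graded_right_ideal_def right_ideal_def)

text \<open>Bounds the graded radical from below, for the failures of nilpotency. If a gr-maximal
  \<open>M\<close> missed \<open>?E\<close>, adjoining \<open>?E\<close> would give the whole ring.
  But multiples of \<open>?E\<close> have (i, i) entry 0, so \<open>elementary i i 1\<close> would
  already come from \<open>M\<close>, and with it \<open>?E\<close>.\<close>

lemma elementary_mem_rad_gr:
  assumes "i < j"
  shows "elementary i j 1 \<in> rad_gr (UT TYPE('i::order) TYPE('a::ring_1))"
  unfolding rad_gr_def
proof safe
  fix M :: "('i, 'a) ut set"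
  assume M: "gr_maximal_right_ideal (UT TYPE('i) TYPE('a)) M"
  let ?E = "elementary i j 1 :: ('i, 'a) ut"
  have rM: "right_ideal M" and gM: "\<And>X k. X \<in> M \<Longrightarrow> elementary k k 1 * X \<in> M"
    using M by (auto simp: gr_maximal_right_ideal_def graded_right_ideal_UT_iff)
  show "?E \<in> M"
  proof (rule ccontr)
    assume "?E \<notin> M"
    define N where "N = {x + y | x y. x \<in> M \<and> y \<in> {?E * r | r. r \<in> UNIV}}"
    have NI: "x + ?E * r \<in> N" if "x \<in> M" for x r
      using that unfolding N_def by blast
    have rN: "right_ideal N"
      unfolding N_def by (intro right_ideal_plus right_ideal_mult_left rM) (simp add: right_ideal_def)
    have "elementary k k 1 * X \<in> N" if "X \<in> N" for X k
    proof -
      obtain x r where "X = x + ?E * r" "x \<in> M"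
        using \<open>X \<in> N\<close> unfolding N_def by blast
      then have X: "elementary k k 1 * X = elementary k k 1 * x + elementary k k 1 * ?E * r"
        by (simp add: distrib_left mult.assoc)
      \<comment> \<open>Left multiplication by a diagonal idempotent either fixes \<open>?E\<close>
        or kills it; so \<open>N\<close> is graded again.\<close>
      have "elementary k k 1 * ?E * r = ?E * (if k = i then r else 0)"
        using assms by (simp add: elementary_mult)
      then show ?thesis
        using NI[OF gM[OF \<open>x \<in> M\<close>], of k "if k = i then r else 0"] X by simp
    qed
    with rN have "graded_right_ideal (UT TYPE('i) TYPE('a)) N"
      by (simp add: graded_right_ideal_UT_iff)
    moreover have "M \<subseteq> N"
      using NI[of _ 0] by auto
    moreover have "?E \<in> N"
      using NI[of 0 "elementary j j 1"] rM assms by (simp add: right_ideal_def elementary_mult)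
    then have "N \<noteq> M"
      using \<open>?E \<notin> M\<close> by blast
    ultimately have "N = UNIV"
      using M unfolding gr_maximal_right_ideal_def by blast
    then obtain x r where xr: "elementary i i 1 = x + ?E * r" "x \<in> M"
      unfolding N_def by blast
    have "entry (elementary i i 1) i i = entry (x + ?E * r) i i"
      by (simp only: xr)
    \<comment> \<open>The (i, i) entry of \<open>?E * r\<close> is the entry of \<open>r\<close> at
      (j, i), which lies below the diagonal.\<close>
    moreover have "entry r j i = 0"
      using assms by (intro entry_eq_0) auto
    ultimately have "entry x i i = 1"
      using assms by (simp add: entry_simps less_imp_le)
    then have "elementary i i 1 = elementary i i 1 * x * elementary i i 1"
      by (simp flip: elementary_part)
    then have "elementary i i 1 \<in> M"
      using gM[OF xr(2)] rM by (metis right_ideal_def)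
    then have "elementary i i 1 * ?E \<in> M"
      using rM by (simp add: right_ideal_def)
    with \<open>?E \<notin> M\<close> assms show False
      by (simp add: elementary_mult)
  qed
qed

section \<open>Vanishing of ideal powers in a given row or column\<close>

lemma entry_ideal_power_diag:
  assumes "n > 0" and "\<And>X. X \<in> D \<Longrightarrow> entry X i i \<in> (J :: 'a::ring set)"
    and "X \<in> ideal_power D n"
  shows "entry X i i \<in> ideal_power J n"
  using assms(1,3)
proof (induction n arbitrary: X rule: nat_induct_non_zero)
  case (Suc n)
  have "ideal_power D (Suc n) \<subseteq> {X. entry X i i \<in> ideal_power J (Suc n)}"
    unfolding ideal_power_Suc[OF Suc.hyps, of D]
  proof (intro group_closure_minimal subsetI)
    fix Z assume "Z \<in> {x * y |x y. x \<in> ideal_power D n \<and> y \<in> D}"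
    then obtain x y where "Z = x * y" "entry x i i \<in> ideal_power J n" "entry y i i \<in> J"
      using Suc.IH assms(2) by blast
    then show "Z \<in> {X. entry X i i \<in> ideal_power J (Suc n)}"
      using mult_in_ideal_power_Suc[OF Suc.hyps] by (simp add: entry_mult_diag)
  qed (simp_all add: ideal_power_Suc[OF Suc.hyps] entry_simps group_closure.diff)
  with Suc.prems show ?case
    by blast
qed (use assms in simp)

lemma finite_common_bound:
  fixes P :: "'b \<Rightarrow> nat \<Rightarrow> bool"
  assumes "finite K" and "\<And>k. k \<in> K \<Longrightarrow> \<exists>n. P k n" and "\<And>k m n. P k m \<Longrightarrow> m \<le> n \<Longrightarrow> P k n"
  obtains N where "N > 0" and "\<And>k. k \<in> K \<Longrightarrow> P k N"
proof -
  obtain f where f: "\<And>k. k \<in> K \<Longrightarrow> P k (f k)"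
    using assms(2) by metis
  \<comment> \<open>The sum dominates every \<open>f k\<close>; the \<open>Suc\<close> keeps the
    bound positive even for empty \<open>K\<close>, which occurs at an extremal index.\<close>
  have "P k (Suc (sum f K))" if "k \<in> K" for k
    using assms(3)[OF f[OF that]] member_le_sum[OF that, of f] assms(1) by simp
  then show thesis
    using that by blast
qed

lemma wfp_greater_if_finite:
  "(\<And>i :: 'i::order. finite {i<..}) \<Longrightarrow> wfp ((>) :: 'i \<Rightarrow> _)"
  by (rule wfp_if_convertible_to_nat[where f = "\<lambda>i. card {i<..}"]) (auto intro!: psubset_card_mono)

lemma wfp_less_if_finite:
  "(\<And>i :: 'i::order. finite {..<i}) \<Longrightarrow> wfp ((<) :: 'i \<Rightarrow> _)"
  by (rule wfp_if_convertible_to_nat[where f = "\<lambda>i. card {..<i}"]) (auto intro!: psubset_card_mono)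

text \<open>The first \<open>m\<close> factors handle paths that stay at \<open>i\<close>, the last
  \<open>N\<close> those that have left it: \<open>N\<close> is a common exponent for the finitely
  many rows above \<open>i\<close>.\<close>

lemma row_ideal_power_eq_0:
  fixes D :: "('i::order, 'a::ring) ut set"
  assumes D: "right_ideal D" "\<And>X i. X \<in> D \<Longrightarrow> entry X i i \<in> J"
    and J: "m > 0" "ideal_power J m = {0}" and fin: "\<And>i :: 'i. finite {i<..}"
  shows "\<exists>n>0. \<forall>X\<in>ideal_power D n. \<forall>q. entry X i q = 0"
proof (induction i rule: wfp_induct_rule[OF wfp_greater_if_finite[OF fin]])
  case (1 i)
  obtain N where N: "N > 0" "\<And>k. k \<in> {i<..} \<Longrightarrow> \<forall>X\<in>ideal_power D N. \<forall>q. entry X k q = 0"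
    by (rule finite_common_bound[OF fin[of i],
          where P = "\<lambda>k n. \<forall>X\<in>ideal_power D n. \<forall>q. entry X k q = 0"])
      (use 1 ideal_power_antimono[OF D(1)] in blast)+
  have "ideal_power D (m + N) \<subseteq> {X. \<forall>q. entry X i q = 0}"
  proof (rule order_trans[OF ideal_power_add[OF J(1) N(1)]], rule group_closure_minimal, safe)
    fix x y q assume x: "x \<in> ideal_power D m" and y: "y \<in> ideal_power D N"
    have "entry x i i = 0"
      using entry_ideal_power_diag[OF J(1) D(2) x] J(2) by blast
    \<comment> \<open>For \<open>k = i\<close> the first factor vanishes, for \<open>k > i\<close>
      the second by the choice of \<open>N\<close>, and for all other \<open>k\<close> the first by
      triangularity.\<close>
    then have "entry x i k * entry y k q = 0" for k
      using N(2) y entry_eq_0[of i _ x] by (metis greaterThan_iff mult_zero_left mult_zero_right order_le_less)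
    then show "entry (x * y) i q = 0"
      by (simp add: times_ut.rep_eq)
  qed (auto simp: entry_simps)
  with J(1) show ?case
    by (intro exI[of _ "m + N"]) auto
qed

text \<open>In a column a path ends at \<open>j\<close> instead of starting there, so the block of
  \<open>m\<close> diagonal factors now stands last.\<close>

lemma col_ideal_power_eq_0:
  fixes D :: "('i::order, 'a::ring) ut set"
  assumes D: "right_ideal D" "\<And>X i. X \<in> D \<Longrightarrow> entry X i i \<in> J"
    and J: "m > 0" "ideal_power J m = {0}" and fin: "\<And>i :: 'i. finite {..<i}"
  shows "\<exists>n>0. \<forall>X\<in>ideal_power D n. \<forall>p. entry X p j = 0"
proof (induction j rule: wfp_induct_rule[OF wfp_less_if_finite[OF fin]])
  case (1 j)
  obtain N where N: "N > 0" "\<And>k. k \<in> {..<j} \<Longrightarrow> \<forall>X\<in>ideal_power D N. \<forall>p. entry X p k = 0"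
    by (rule finite_common_bound[OF fin[of j],
          where P = "\<lambda>k n. \<forall>X\<in>ideal_power D n. \<forall>p. entry X p k = 0"])
      (use 1 ideal_power_antimono[OF D(1)] in blast)+
  have "ideal_power D (N + m) \<subseteq> {X. \<forall>p. entry X p j = 0}"
  proof (rule order_trans[OF ideal_power_add[OF N(1) J(1)]], rule group_closure_minimal, safe)
    fix x y p assume x: "x \<in> ideal_power D N" and y: "y \<in> ideal_power D m"
    have "entry y j j = 0"
      using entry_ideal_power_diag[OF J(1) D(2) y] J(2) by blast
    then have "entry x p k * entry y k j = 0" for k
      using N(2) x entry_eq_0[of _ j y] by (metis lessThan_iff mult_zero_left mult_zero_right order_le_less)
    then show "entry (x * y) p j = 0"
      by (simp add: times_ut.rep_eq)
  qed (auto simp: entry_simps)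
  with J(1) show ?case
    by (intro exI[of _ "N + m"]) auto
qed

lemma right_objectwise_nilpotent_UT_iff:
  "right_objectwise_nilpotent (UT TYPE('i::order) TYPE('a::ring_1)) D \<longleftrightarrow>
    (\<forall>i. \<exists>n>0. {elementary i i 1 * X | X. X \<in> ideal_power D n} = {0})"
  by (auto simp: right_objectwise_nilpotent_def UT_def)

lemma left_objectwise_nilpotent_UT_iff:
  "left_objectwise_nilpotent (UT TYPE('i::order) TYPE('a::ring_1)) D \<longleftrightarrow>
    (\<forall>i. \<exists>n>0. {X * elementary i i 1 | X. X \<in> ideal_power D n} = {0})"
  by (auto simp: left_objectwise_nilpotent_def UT_def)

lemma right_objectwise_nilpotent_rad_gr:
  assumes "right_artinian TYPE('a::ring_1)" and "\<And>i :: 'i::order. finite {i<..}"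
  shows "right_objectwise_nilpotent (UT TYPE('i) TYPE('a)) (rad_gr (UT TYPE('i) TYPE('a)))"
    (is "right_objectwise_nilpotent _ ?D")
proof -
  obtain m where m: "m > 0" "ideal_power (jacobson :: 'a set) m = {0}"
    using jacobson_nilpotent assms(1) by blast
  have "\<exists>n>0. {elementary i i 1 * X | X. X \<in> ideal_power ?D n} = {0}" for i
  proof -
    obtain n where n: "n > 0" "\<And>X q. X \<in> ideal_power ?D n \<Longrightarrow> entry X i q = 0"
      using row_ideal_power_eq_0[OF right_ideal_rad_gr entry_rad_gr_diag m assms(2)] by meson
    then have "elementary i i 1 * X = 0" if "X \<in> ideal_power ?D n" for X
      using that by (intro ut_eqI) (simp add: entry_simps)
    moreover have "0 \<in> ideal_power ?D n"
      using right_ideal_ideal_power[OF right_ideal_rad_gr] by (auto simp: right_ideal_def)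
    ultimately have "{elementary i i 1 * X | X. X \<in> ideal_power ?D n} = {0}"
      by force
    with n(1) show ?thesis
      by blast
  qed
  then show ?thesis
    by (simp add: right_objectwise_nilpotent_UT_iff)
qed

lemma left_objectwise_nilpotent_rad_gr:
  assumes "left_artinian TYPE('a::ring_1)" and "\<And>i :: 'i::order. finite {..<i}"
  shows "left_objectwise_nilpotent (UT TYPE('i) TYPE('a)) (rad_gr (UT TYPE('i) TYPE('a)))"
    (is "left_objectwise_nilpotent _ ?D")
proof -
  obtain m where m: "m > 0" "ideal_power (jacobson :: 'a set) m = {0}"
    using jacobson_nilpotent assms(1) by blast
  have "\<exists>n>0. {X * elementary j j 1 | X. X \<in> ideal_power ?D n} = {0}" for j
  proof -
    obtain n where n: "n > 0" "\<And>X p. X \<in> ideal_power ?D n \<Longrightarrow> entry X p j = 0"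
      using col_ideal_power_eq_0[OF right_ideal_rad_gr entry_rad_gr_diag m assms(2)] by meson
    then have "X * elementary j j 1 = 0" if "X \<in> ideal_power ?D n" for X
      using that by (intro ut_eqI) (simp add: entry_simps)
    moreover have "0 \<in> ideal_power ?D n"
      using right_ideal_ideal_power[OF right_ideal_rad_gr] by (auto simp: right_ideal_def)
    ultimately have "{X * elementary j j 1 | X. X \<in> ideal_power ?D n} = {0}"
      by force
    with n(1) show ?thesis
      by blast
  qed
  then show ?thesis
    by (simp add: left_objectwise_nilpotent_UT_iff)
qed

section \<open>Index chains and the failure of nilpotency\<close>

lemma elementary_mem_ideal_power:
  assumes "n > 0" and "\<And>i j. i < j \<Longrightarrow> elementary i j (1 :: 'a::ring_1) \<in> D"
    and "\<And>k. k < n \<Longrightarrow> c k < c (Suc k)"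
  shows "c 0 < c n \<and> elementary (c 0) (c n) 1 \<in> ideal_power D n"
  using assms(1,3)
proof (induction n rule: nat_induct_non_zero)
  case (Suc n)
  then have lt: "c 0 < c n" "c n < c (Suc n)" and mem: "elementary (c 0) (c n) 1 \<in> ideal_power D n"
    by auto
  \<comment> \<open>The product telescopes. The inequality \<open>c 0 < c n\<close> is carried
    through the induction because \<open>elementary_mult\<close> asks for it.\<close>
  have "elementary (c 0) (c n) 1 * elementary (c n) (c (Suc n)) 1 \<in> ideal_power D (Suc n)"
    using mult_in_ideal_power_Suc[OF Suc.hyps mem assms(2)[OF lt(2)]] .
  with lt show ?case
    by (auto simp: elementary_mult)
qed (use assms in auto)

text \<open>By linearity any \<open>n\<close> elements above \<open>i\<close> can be sorted into a
  chain. Read contrapositively, it turns a bound on chain lengths into finiteness of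
  \<open>{i<..}\<close>.\<close>

lemma infinite_greater_chain:
  assumes "infinite {i :: 'i::linorder <..}"
  obtains ks where "length ks = n" and "sorted_wrt (<) (i # ks)"
proof -
  obtain B where B: "finite B" "card B = n" "B \<subseteq> {i<..}"
    using infinite_arbitrarily_large[OF assms] by blast
  then show thesis
    by (intro that[of "sorted_list_of_set B"]) (auto simp: subset_iff)
qed

lemma infinite_less_chain:
  assumes "infinite {..< j :: 'i::linorder}"
  obtains ks where "length ks = n" and "sorted_wrt (<) (ks @ [j])"
proof -
  obtain B where B: "finite B" "card B = n" "B \<subseteq> {..<j}"
    using infinite_arbitrarily_large[OF assms] by blast
  then show thesis
    by (intro that[of "sorted_list_of_set B"]) (auto simp: subset_iff sorted_wrt_append)
qed

text \<open>Here \<open>0 \<noteq> 1\<close> from the class \<open>ring_1\<close> enters; over the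
  zero ring every power would vanish.\<close>

lemma elementary_1_neq_0: "i \<le> j \<Longrightarrow> elementary i j (1 :: 'a::ring_1) \<noteq> 0"
proof
  assume "i \<le> j" and "elementary i j (1 :: 'a) = 0"
  then have "entry (elementary i j (1 :: 'a)) i j = entry 0 i j"
    by simp
  with \<open>i \<le> j\<close> show False
    by (simp add: entry_simps)
qed

lemma not_right_objectwise_nilpotent_rad_gr:
  assumes "infinite {i :: 'i::linorder <..}"
  shows "\<not> right_objectwise_nilpotent (UT TYPE('i) TYPE('a::ring_1)) (rad_gr (UT TYPE('i) TYPE('a)))"
    (is "\<not> right_objectwise_nilpotent _ ?D")
proof
  assume "right_objectwise_nilpotent (UT TYPE('i) TYPE('a)) ?D"
  then obtain n where n: "n > 0" "{elementary i i 1 * X | X. X \<in> ideal_power ?D n} = {0}"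
    unfolding right_objectwise_nilpotent_UT_iff by blast
  obtain ks where ks: "length ks = n" "sorted_wrt (<) (i # ks)"
    using infinite_greater_chain[OF assms] by blast
  \<comment> \<open>The list has \<open>n + 1\<close> entries, so \<open>c\<close> makes exactly
    \<open>n\<close> strict steps, one for each factor of the product.\<close>
  define c where "c = (!) (i # ks)"
  have step: "c k < c (Suc k)" if "k < n" for k
    unfolding c_def using sorted_wrt_nth_less[OF ks(2), of k "Suc k"] ks(1) that by simp
  have "c 0 = i"
    by (simp add: c_def)
  with elementary_mem_ideal_power[where c = c, OF n(1) elementary_mem_rad_gr step]
  have "i < c n \<and> elementary i (c n) 1 \<in> ideal_power ?D n"
    by simp
  then have "elementary i i 1 * elementary i (c n) 1 \<in> {0 :: ('i, 'a) ut}" and le: "i \<le> c n"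
    using n(2) by auto
  then show False
    by (simp add: elementary_mult elementary_1_neq_0)
qed

lemma not_left_objectwise_nilpotent_rad_gr:
  assumes "infinite {..< j :: 'i::linorder}"
  shows "\<not> left_objectwise_nilpotent (UT TYPE('i) TYPE('a::ring_1)) (rad_gr (UT TYPE('i) TYPE('a)))"
    (is "\<not> left_objectwise_nilpotent _ ?D")
proof
  assume "left_objectwise_nilpotent (UT TYPE('i) TYPE('a)) ?D"
  then obtain n where n: "n > 0" "{X * elementary j j 1 | X. X \<in> ideal_power ?D n} = {0}"
    unfolding left_objectwise_nilpotent_UT_iff by blast
  obtain ks where ks: "length ks = n" "sorted_wrt (<) (ks @ [j])"
    using infinite_less_chain[OF assms] by blast
  define i where "i = (ks @ [j]) ! 0"
  have "(ks @ [j]) ! n = j"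
    using ks(1) by (simp add: nth_append)
  then have "i < j \<and> elementary i j 1 \<in> ideal_power ?D n"
    using elementary_mem_ideal_power[OF n(1), of ?D "(!) (ks @ [j])"] elementary_mem_rad_gr[where 'i = 'i and 'a = 'a]
      sorted_wrt_nth_less[OF ks(2)] ks(1) by (simp add: i_def)
  then have "elementary i j 1 * elementary j j 1 \<in> {0 :: ('i, 'a) ut}" and le: "i \<le> j"
    using n(2) by auto
  then show False
    by (simp add: elementary_mult elementary_1_neq_0)
qed


section \<open>Chain conditions\<close>

text \<open>For each \<open>N\<close>, \<open>g N\<close> is a position from \<open>N\<close> on
  whose value is \<open>r\<close>-minimal among all values from \<open>N\<close> on. Iterating
  \<open>g\<close> just past the last chosen position gives \<open>f\<close>.\<close>

lemma wfp_subseq: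
  fixes \<kappa> :: "nat \<Rightarrow> 'i"
  assumes "wfp r"
  obtains f :: "nat \<Rightarrow> nat" where "strict_mono f" and "\<And>m. \<not> r (\<kappa> (f (Suc m))) (\<kappa> (f m))"
proof -
  have "\<exists>n\<ge>N. \<forall>m\<ge>N. \<not> r (\<kappa> m) (\<kappa> n)" for N
    using assms[unfolded wfp_eq_minimal, rule_format, of "\<kappa> N" "\<kappa> ` {N..}"] by fastforce
  then obtain g where g: "\<And>N. g N \<ge> N" "\<And>N m. m \<ge> N \<Longrightarrow> \<not> r (\<kappa> m) (\<kappa> (g N))"
    by metis
  define f where "f = rec_nat (g 0) (\<lambda>_ k. g (Suc k))"
  have Suc: "f (Suc m) = g (Suc (f m))" for m
    by (simp add: f_def)
  then have mono: "strict_mono f"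
    unfolding strict_mono_Suc_iff using g(1) by (metis Suc_le_lessD)
  \<comment> \<open>Every chosen position is minimal for a tail that starts no later than itself,
    hence against all later choices.\<close>
  have ex: "\<exists>N\<le>f m. f m = g N" for m
  proof (cases m)
    case 0
    then show ?thesis
      by (auto simp: f_def)
  next
    case (Suc k)
    then show ?thesis
      using g(1)[of "Suc (f k)"] \<open>\<And>m. f (Suc m) = g (Suc (f m))\<close> by auto
  qed
  have "\<not> r (\<kappa> (f (Suc m))) (\<kappa> (f m))" for m
  proof -
    obtain N where "N \<le> f m" "f m = g N"
      using ex by blast
    moreover have "f m \<le> f (Suc m)"
      using mono by (simp add: strict_mono_less_eq)
    ultimately show ?thesis
      using g(2)[of N "f (Suc m)"] by simp
  qed
  with mono show thesis
    by (rule that)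
qed

text \<open>The diagonal sequence \<open>V m = C (f m) (\<kappa> (f m))\<close> works for any \<open>f\<close> along which \<open>\<kappa>\<close> does not descend.\<close>

lemma wfp_diagonal_chain:
  fixes C :: "nat \<Rightarrow> 'i \<Rightarrow> 'a set"
  assumes "wfp r" and dec: "\<And>n k. C (Suc n) k \<subseteq> C n k"
    and strict: "\<And>n. C (Suc n) (\<kappa> n) \<noteq> C n (\<kappa> n)"
    and mono: "\<And>n p q. \<not> r (\<kappa> q) (\<kappa> p) \<Longrightarrow> C n (\<kappa> q) \<subseteq> C n (\<kappa> p)"
  obtains V where "\<And>m. V (Suc m) \<subset> V m" and "\<And>m. \<exists>n k. V m = C n k"
proof -
  obtain f where f: "strict_mono f" "\<And>m. \<not> r (\<kappa> (f (Suc m))) (\<kappa> (f m))"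
    using wfp_subseq[OF assms(1)] by blast
  have "C (f (Suc m)) (\<kappa> (f (Suc m))) \<subset> C (f m) (\<kappa> (f m))" for m
  proof -
    have "Suc (f m) \<le> f (Suc m)"
      using f(1) by (simp add: strict_mono_Suc_iff Suc_le_eq)
    then have "C (f (Suc m)) (\<kappa> (f (Suc m))) \<subseteq> C (Suc (f m)) (\<kappa> (f (Suc m)))"
      by (rule lift_Suc_antimono_le[where f = "\<lambda>n. C n _", OF dec])
    also have "\<dots> \<subseteq> C (Suc (f m)) (\<kappa> (f m))"
      by (rule mono[OF f(2)])
    also have "\<dots> \<subset> C (f m) (\<kappa> (f m))"
      using dec strict by blast
    finally show ?thesis .
  qed
  then show thesis
    by (intro that[of "\<lambda>m. C (f m) (\<kappa> (f m))"]) blast+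
qed

lemma local_one_UT: "local_one (UT TYPE('i::order) TYPE('a::ring_1)) (i, i) = elementary i i 1"
  by (simp add: UT_def)

text \<open>Row version: right multiplication moves entries to the right, so the coefficient ideals
  at (i, k) grow with \<open>k\<close>. The subsequence must therefore not ascend, and the
  well-founded relation is \<open>>\<close>.\<close>

lemma right_objects_artinian_UT:
  assumes art: "right_artinian TYPE('a::ring_1)" and wf: "wfp ((>) :: 'i::linorder \<Rightarrow> _)"
  shows "right_objects_artinian (UT TYPE('i) TYPE('a))"
proof -
  have impossible: False if graded: "\<And>n. graded_right_ideal (UT TYPE('i) TYPE('a)) (U n)"
      and sub: "\<And>n. U n \<subseteq> {elementary i i 1 * X | X. True}" and strict: "\<And>n. U (Suc n) \<subset> U n"
    for i and U :: "nat \<Rightarrow> ('i, 'a) ut set"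
  proof -
    have U: "right_ideal (U n)" for n
      using graded by (simp add: graded_right_ideal_def)
    then have U0: "0 \<in> U n" for n
      by (simp add: right_ideal_def)
    \<comment> \<open>For \<open>k\<close> not above \<open>i\<close>,
      \<open>elementary i k a\<close> is 0 and \<open>C n k\<close> is everything; strict steps can
      only occur at \<open>k \<ge> i\<close>.\<close>
    define C where "C = (\<lambda>n k. {a. elementary i k a \<in> U n})"
    have "\<exists>k\<ge>i. C (Suc n) k \<noteq> C n k" for n
    proof -
      obtain X where X: "X \<in> U n" "X \<notin> U (Suc n)"
        using strict[of n] by blast
      then obtain Y where Y: "X = elementary i i 1 * Y"
        using sub by blast
      obtain p k where "elementary p k (entry X p k) \<notin> U (Suc n)"
        using X(2) mem_if_parts_mem[of "U (Suc n)" X] U[of "Suc n"] unfolding right_ideal_def by blast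
      \<comment> \<open>A component missing from \<open>U (Suc n)\<close> is nonzero, hence in row
        \<open>i\<close> and not below the diagonal.\<close>
      moreover from this have "p = i" "i \<le> k"
        using U0[of "Suc n"] elementary_eq_0[of p k "entry X p k"]
        by (cases "p \<le> k"; auto simp: Y entry_simps elementary_0 split: if_splits)+
      \<comment> \<open>As \<open>X\<close> is already confined to row \<open>i\<close>, a right
        multiplication alone isolates its component.\<close>
      moreover have "elementary i k (entry X i k) = X * elementary k k 1"
        unfolding elementary_part by (intro ut_eqI) (simp add: Y entry_simps)
      then have "elementary i k (entry X i k) \<in> U n"
        using X(1) U[of n] by (simp add: right_ideal_def)
      ultimately show ?thesis
        unfolding C_def by blast
    qed
    then obtain \<kappa> where \<kappa>: "\<And>n. i \<le> \<kappa> n" "\<And>n. C (Suc n) (\<kappa> n) \<noteq> C n (\<kappa> n)"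
      by metis
    have dec: "C (Suc n) k \<subseteq> C n k" for n k
      using strict[of n] unfolding C_def by blast
    have mono: "C n (\<kappa> q) \<subseteq> C n (\<kappa> p)" if "\<not> \<kappa> q > \<kappa> p" for n p q
    proof -
      from that have "elementary i (\<kappa> q) a * elementary (\<kappa> q) (\<kappa> p) 1 = elementary i (\<kappa> p) a" for a :: 'a
        using \<kappa>(1)[of q] by (simp add: elementary_mult)
      then show ?thesis
        using U[of n] unfolding C_def right_ideal_def by (metis (mono_tags, lifting) mem_Collect_eq subsetI)
    qed
    obtain V where V: "\<And>m. V (Suc m) \<subset> V m" "\<And>m. \<exists>n k. V m = C n k"
      using wfp_diagonal_chain[where C = C and \<kappa> = \<kappa>, OF wf dec \<kappa>(2) mono] by blast
    have "elementary i k (a * r) = elementary i k a * elementary k k r" for k and a r :: 'a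
      by (intro ut_eqI) (simp add: entry_simps)
    then have "right_ideal (C n k)" for n k
      using U[of n] by (simp add: C_def right_ideal_def elementary_0 elementary_diff)
    with V have "right_ideal (V m) \<and> V (Suc m) \<subset> V m" for m
      by metis
    with art show False
      unfolding right_artinian_def by blast
  qed
  show ?thesis
    unfolding right_objects_artinian_def
  proof (intro ballI notI)
    let ?R = "UT TYPE('i) TYPE('a)"
    fix e assume "e \<in> objects ?R"
    then obtain i where e: "e = (i, i)"
      by (auto simp: UT_def)
    assume "\<exists>U. \<forall>n. graded_right_ideal ?R (U n) \<and>
      U n \<subseteq> {local_one ?R e * x | x. True} \<and> U (Suc n) \<subset> U n"
    then obtain U where "\<forall>n. graded_right_ideal ?R (U n) \<and>
      U n \<subseteq> {elementary i i 1 * x | x. True} \<and> U (Suc n) \<subset> U n"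
      unfolding e local_one_UT by blast
    then show False
      by (intro impossible[of U i]) blast+
  qed
qed

text \<open>Left multiplication moves entries up a column, so the coefficient ideals shrink as
  \<open>k\<close> grows. Well-foundedness of \<open><\<close> is the condition on the index set,
  which admits columns with infinitely many indices, as in well-ordered sets beyond
  \<omega>.\<close>

lemma left_objects_artinian_UT:
  assumes art: "left_artinian TYPE('a::ring_1)" and wf: "wfp ((<) :: 'i::linorder \<Rightarrow> _)"
  shows "left_objects_artinian (UT TYPE('i) TYPE('a))"
proof -
  have impossible: False if graded: "\<And>n. graded_left_ideal (UT TYPE('i) TYPE('a)) (U n)"
      and sub: "\<And>n. U n \<subseteq> {X * elementary j j 1 | X. True}" and strict: "\<And>n. U (Suc n) \<subset> U n"
    for j and U :: "nat \<Rightarrow> ('i, 'a) ut set"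
  proof -
    have U: "left_ideal (U n)" for n
      using graded by (simp add: graded_left_ideal_def)
    then have U0: "0 \<in> U n" for n
      by (simp add: left_ideal_def)
    define C where "C = (\<lambda>n k. {a. elementary k j a \<in> U n})"
    have "\<exists>k\<le>j. C (Suc n) k \<noteq> C n k" for n
    proof -
      obtain X where X: "X \<in> U n" "X \<notin> U (Suc n)"
        using strict[of n] by blast
      then obtain Y where Y: "X = Y * elementary j j 1"
        using sub by blast
      obtain k q where "elementary k q (entry X k q) \<notin> U (Suc n)"
        using X(2) mem_if_parts_mem[of "U (Suc n)" X] U[of "Suc n"] unfolding left_ideal_def by blast
      moreover from this have "q = j" "k \<le> j"
        using U0[of "Suc n"] elementary_eq_0[of k q "entry X k q"]
        by (cases "k \<le> q"; auto simp: Y entry_simps elementary_0 split: if_splits)+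
      moreover have "elementary k j (entry X k j) = elementary k k 1 * X"
        unfolding elementary_part by (intro ut_eqI) (simp add: Y entry_simps)
      then have "elementary k j (entry X k j) \<in> U n"
        using X(1) U[of n] by (simp add: left_ideal_def)
      ultimately show ?thesis
        unfolding C_def by blast
    qed
    then obtain \<kappa> where \<kappa>: "\<And>n. \<kappa> n \<le> j" "\<And>n. C (Suc n) (\<kappa> n) \<noteq> C n (\<kappa> n)"
      by metis
    have dec: "C (Suc n) k \<subseteq> C n k" for n k
      using strict[of n] unfolding C_def by blast
    have mono: "C n (\<kappa> q) \<subseteq> C n (\<kappa> p)" if "\<not> \<kappa> q < \<kappa> p" for n p q
    proof -
      from that have "elementary (\<kappa> p) (\<kappa> q) 1 * elementary (\<kappa> q) j a = elementary (\<kappa> p) j a" for a :: 'a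
        using \<kappa>(1)[of q] by (simp add: elementary_mult)
      then show ?thesis
        using U[of n] unfolding C_def left_ideal_def by (metis (mono_tags, lifting) mem_Collect_eq subsetI)
    qed
    obtain V where V: "\<And>m. V (Suc m) \<subset> V m" "\<And>m. \<exists>n k. V m = C n k"
      using wfp_diagonal_chain[where C = C and \<kappa> = \<kappa>, OF wf dec \<kappa>(2) mono] by blast
    have "elementary k j (r * a) = elementary k k r * elementary k j a" for k and a r :: 'a
      by (intro ut_eqI) (simp add: entry_simps)
    then have "left_ideal (C n k)" for n k
      using U[of n] by (simp add: C_def left_ideal_def elementary_0 elementary_diff)
    with V have "left_ideal (V m) \<and> V (Suc m) \<subset> V m" for m
      by metis
    with art show False
      unfolding left_artinian_def by blast
  qed
  show ?thesis
    unfolding left_objects_artinian_def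
  proof (intro ballI notI)
    let ?R = "UT TYPE('i) TYPE('a)"
    fix e assume "e \<in> objects ?R"
    then obtain j where e: "e = (j, j)"
      by (auto simp: UT_def)
    assume "\<exists>U. \<forall>n. graded_left_ideal ?R (U n) \<and>
      U n \<subseteq> {x * local_one ?R e | x. True} \<and> U (Suc n) \<subset> U n"
    then obtain U where "\<forall>n. graded_left_ideal ?R (U n) \<and>
      U n \<subseteq> {x * elementary j j 1 | x. True} \<and> U (Suc n) \<subset> U n"
      unfolding e local_one_UT by blast
    then show False
      by (intro impossible[of U j]) blast+
  qed
qed


section \<open>Well-ordered index sets\<close>

lemma Well_order_imp_wfp_less:
  assumes "Well_order {(i, j :: 'i::linorder). i \<le> j}"
  shows "wfp ((<) :: 'i \<Rightarrow> _)"
proof -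
  have "{(i, j :: 'i). i \<le> j} - Id = {(i, j). i < j}"
    by auto
  with assms show ?thesis
    by (simp add: well_order_on_def wfp_def)
qed

text \<open>A minimal element is least by linearity, so all other elements lie above it.\<close>

lemma infinite_greater_if_wfp:
  assumes "infinite (UNIV :: 'i::linorder set)" and "wfp ((<) :: 'i::linorder \<Rightarrow> _)"
  obtains i :: "'i::linorder" where "infinite {i<..}"
proof -
  obtain i :: 'i where "\<And>k. \<not> k < i"
    using assms(2) unfolding wfp_eq_minimal by (metis UNIV_I)
  then have "UNIV = insert i {i<..}"
    by (force simp: not_less order_le_less)
  with assms(1) show thesis
    using that[of i] by (metis finite_insert)
qed

text \<open>A strict embedding of the natural numbers has a proper initial segment as its range; any
  index outside that range exceeds all of it.\<close>

lemma infinite_less_if_natLeq_less: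
  assumes "natLeq <o {(i, j :: 'i::linorder). i \<le> j}"
  obtains j :: "'i::linorder" where "infinite {..<j}"
proof -
  let ?r = "{(i, j :: 'i). i \<le> j}"
  have fld: "Field ?r = UNIV"
    by (auto simp: Field_def)
  obtain f where wo: "Well_order natLeq" "Well_order ?r" and f: "embedS natLeq ?r f"
    using assms unfolding ordLess_def by blast
  then have emb: "embed natLeq ?r f" and nbij: "\<not> bij_betw f UNIV (UNIV :: 'i set)"
    unfolding embedS_def Field_natLeq fld by simp_all
  have "inj f"
    using embed_inj_on[OF wo(1) emb] by (simp add: Field_natLeq)
  with nbij have "range f \<noteq> UNIV"
    by (simp add: bij_betw_def)
  then obtain j where j: "j \<notin> range f"
    by blast
  have "ofilter ?r (range f)"
    using embed_Field_ofilter[OF wo emb] by (simp add: Field_natLeq)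
  then have down: "k \<in> range f" if "k \<le> f n" for k n
    using that wo_rel.ofilter_def[of ?r] wo(2) by (auto simp: wo_rel_def under_def)
  \<comment> \<open>If \<open>j\<close> were at most some \<open>f n\<close>, it would lie in the
    downward closed range.\<close>
  have "range f \<subseteq> {..<j}"
    using down j by (force simp: not_le[symmetric])
  then have "infinite {..<j}"
    using \<open>inj f\<close> finite_subset finite_imageD infinite_UNIV_nat by blast
  then show thesis
    by (rule that)
qed

text \<open>Ordinals are represented by well-orders: \<open>natLeq <o lam\<close> says \<omega> <
  \<lambda>, and the isomorphism \<open>=o\<close> identifies the order on \<open>'i\<close> with
  the ordinals below \<lambda>. Types are nonempty, as the index set has to be. Since the empty
  chain always exists, a bound \<open>n\<close> on chains is automatically positive.\<close>

theorem proposition6p6: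
  fixes lam :: "'l rel"
  shows
    "(right_artinian TYPE('a::ring_1) \<and>
       (\<forall>i::'i::linorder. \<exists>n::nat. \<not> (\<exists>ks. length ks = n \<and> sorted_wrt (<) (i # ks))) \<longrightarrow>
       right_objects_artinian (UT TYPE('i) TYPE('a)) \<and>
       right_objectwise_nilpotent (UT TYPE('i) TYPE('a)) (rad_gr (UT TYPE('i) TYPE('a)))) \<and>
     (left_artinian TYPE('a) \<and>
       (\<forall>j::'i. \<exists>n::nat. \<not> (\<exists>ks. length ks = n \<and> sorted_wrt (<) (ks @ [j]))) \<longrightarrow>
       left_objects_artinian (UT TYPE('i) TYPE('a)) \<and>
       left_objectwise_nilpotent (UT TYPE('i) TYPE('a)) (rad_gr (UT TYPE('i) TYPE('a)))) \<and>
     (left_artinian TYPE('a) \<and> infinite (UNIV :: 'i set) \<and> Well_order {(i, j :: 'i). i \<le> j} \<longrightarrow>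
       left_objects_artinian (UT TYPE('i) TYPE('a)) \<and>
       \<not> right_objectwise_nilpotent (UT TYPE('i) TYPE('a)) (rad_gr (UT TYPE('i) TYPE('a)))) \<and>
     (left_artinian TYPE('a) \<longrightarrow>
       left_objects_artinian (UT TYPE(nat) TYPE('a)) \<and>
       left_objectwise_nilpotent (UT TYPE(nat) TYPE('a)) (rad_gr (UT TYPE(nat) TYPE('a))) \<and>
       \<not> right_objectwise_nilpotent (UT TYPE(nat) TYPE('a)) (rad_gr (UT TYPE(nat) TYPE('a)))) \<and>
     (left_artinian TYPE('a) \<and> natLeq <o lam \<and> {(i, j :: 'i). i \<le> j} =o lam \<longrightarrow>
       left_objects_artinian (UT TYPE('i) TYPE('a)) \<and>
       \<not> left_objectwise_nilpotent (UT TYPE('i) TYPE('a)) (rad_gr (UT TYPE('i) TYPE('a))) \<and>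
       \<not> right_objectwise_nilpotent (UT TYPE('i) TYPE('a)) (rad_gr (UT TYPE('i) TYPE('a))))"
proof -
  have nat: "finite {..<j}" for j :: nat
    by simp
  have wf_nat: "wfp ((<) :: nat \<Rightarrow> _)" and inf_nat: "infinite {0 :: nat <..}"
    using wfp_less_if_finite[OF nat] by (simp_all add: infinite_Ioi)
  have part1: "right_objects_artinian (UT TYPE('i) TYPE('a)) \<and>
      right_objectwise_nilpotent (UT TYPE('i) TYPE('a)) (rad_gr (UT TYPE('i) TYPE('a)))"
    if art: "right_artinian TYPE('a)"
      and chains: "\<forall>i::'i. \<exists>n::nat. \<not> (\<exists>ks. length ks = n \<and> sorted_wrt (<) (i # ks))"
  proof -
    have fin: "finite {i :: 'i <..}" for i
      using chains infinite_greater_chain by metis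
    show ?thesis
      using right_objects_artinian_UT[OF art wfp_greater_if_finite[OF fin]]
        right_objectwise_nilpotent_rad_gr[OF art fin] by blast
  qed
  have part2: "left_objects_artinian (UT TYPE('i) TYPE('a)) \<and>
      left_objectwise_nilpotent (UT TYPE('i) TYPE('a)) (rad_gr (UT TYPE('i) TYPE('a)))"
    if art: "left_artinian TYPE('a)"
      and chains: "\<forall>j::'i. \<exists>n::nat. \<not> (\<exists>ks. length ks = n \<and> sorted_wrt (<) (ks @ [j]))"
  proof -
    have fin: "finite {..<j}" for j :: 'i
      using chains infinite_less_chain by metis
    show ?thesis
      using left_objects_artinian_UT[OF art wfp_less_if_finite[OF fin]]
        left_objectwise_nilpotent_rad_gr[OF art fin] by blast
  qed
  have part3: "left_objects_artinian (UT TYPE('i) TYPE('a)) \<and>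
      \<not> right_objectwise_nilpotent (UT TYPE('i) TYPE('a)) (rad_gr (UT TYPE('i) TYPE('a)))"
    if art: "left_artinian TYPE('a)" and inf: "infinite (UNIV :: 'i set)"
      and wo: "Well_order {(i, j :: 'i). i \<le> j}"
  proof -
    have wf: "wfp ((<) :: 'i \<Rightarrow> _)"
      by (rule Well_order_imp_wfp_less[OF wo])
    obtain i :: 'i where "infinite {i<..}"
      by (rule infinite_greater_if_wfp[OF inf wf])
    then show ?thesis
      using left_objects_artinian_UT[OF art wf] not_right_objectwise_nilpotent_rad_gr by blast
  qed
  have part4: "left_objects_artinian (UT TYPE(nat) TYPE('a)) \<and>
      left_objectwise_nilpotent (UT TYPE(nat) TYPE('a)) (rad_gr (UT TYPE(nat) TYPE('a))) \<and>
      \<not> right_objectwise_nilpotent (UT TYPE(nat) TYPE('a)) (rad_gr (UT TYPE(nat) TYPE('a)))"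
    if "left_artinian TYPE('a)"
    using left_objects_artinian_UT[OF that wf_nat] left_objectwise_nilpotent_rad_gr[OF that nat]
      not_right_objectwise_nilpotent_rad_gr[OF inf_nat] by blast
  have part5: "left_objects_artinian (UT TYPE('i) TYPE('a)) \<and>
      \<not> left_objectwise_nilpotent (UT TYPE('i) TYPE('a)) (rad_gr (UT TYPE('i) TYPE('a))) \<and>
      \<not> right_objectwise_nilpotent (UT TYPE('i) TYPE('a)) (rad_gr (UT TYPE('i) TYPE('a)))"
    if art: "left_artinian TYPE('a)" and lam: "natLeq <o lam"
      and iso: "{(i, j :: 'i). i \<le> j} =o lam"
  proof -
    \<comment> \<open>Moves the comparison with \<omega> from \<open>lam\<close> to the index order,
      where it yields an index with infinitely many predecessors.\<close>
    have "natLeq <o {(i, j :: 'i). i \<le> j}"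
      using ordLess_ordIso_trans[OF lam ordIso_symmetric[OF iso]] .
    then obtain j :: 'i where j: "infinite {..<j}"
      by (rule infinite_less_if_natLeq_less)
    then have "infinite (UNIV :: 'i set)"
      using finite_subset subset_UNIV by blast
    moreover have "Well_order {(i, j :: 'i). i \<le> j}"
      using iso by (simp add: ordIso_def)
    ultimately show ?thesis
      using part3[OF art] not_left_objectwise_nilpotent_rad_gr[OF j] by blast
  qed
  show ?thesis
    using part1 part2 part3 part4 part5 by blast
qed

end
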